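(* Let $\mathcal{C}$ be a triangulated category and let $\mathbf{S}$ be a non-empty set of non-zero objects of $\mathcal{C}$. Assume that $\mathbf{S}$ contains all the stable objects in every stability condition on $\mathcal{C}$. Let $n\ge 2$ and let $q_1,\dots,q_n$ be pairwise distinct positive real numbers. Then the map $$m=m_{q_1}\times\cdots\times m_{q_n}\colon \mathrm{Stab}(\mathcal{C})/\mathbf{C}\to \mathbf{P}^{\mathbf{S}}\times\cdots\times\mathbf{P}^{\mathbf{S}}$$ is injective.
   Context: $\mathrm{Stab}(\mathcal{C})$ is the set of locally finite Bridgeland stability conditions $\tau=(\mathcal{P},Z)$ on $\mathcal{C}$ (slicing $\mathcal{P}$, central charge $Z\colon K(\mathcal{C})\to\mathbf{C}$). The group $\mathbf{C}$ acts on it: for $\omega=a+i\pi b$, $(\omega\cdot\mathcal{P})(\phi)=\mathcal{P}(\phi-b)$ and $\omega\cdot Z=e^{\omega}Z$. An object is stable of phase $\phi$ for $\tau$ if it is a simple object of the abelian category $\mathcal{P}(\phi)$. For $q>0$ and an object $x$ with Harder--Narasimhan factors $a_i$ semistable of phase $\phi_i$, the mass is $m_{q,\tau}(x)=\sum_i q^{\phi_i}|Z(a_i)|$. Let $\mathbf{R}^{\mathbf{S}}$ be the space of functions $\mathbf{S}\to\mathbf{R}$ with the product topology, and $\mathbf{P}^{\mathbf{S}}=(\mathbf{R}^{\mathbf{S}}\setminus\{0\})/\mathbf{R}^{\times}$. The $\mathbf{C}$-action only rescales the function $m_{q,\tau}\colon\mathbf{S}\to\mathbf{R}$, so $\tau\mapsto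 [m_{q,\tau}]$ gives a well-defined map $m_q\colon\mathrm{Stab}(\mathcal{C})/\mathbf{C}\to\mathbf{P}^{\mathbf{S}}$. *)

theory Defs
  imports Complex_Main "HOL-Algebra.Free_Abelian_Groups"
begin

section \<open>Categories\<close>

record ('o, 'm) cat =
  obj :: "'o set"
  arr :: "'m set"
  src :: "'m \<Rightarrow> 'o"
  tgt :: "'m \<Rightarrow> 'o"
  idm :: "'o \<Rightarrow> 'm"
  cmp :: "'m \<Rightarrow> 'm \<Rightarrow> 'm" (infixr "\<cdot>\<index>" 70)

definition Hom :: "('o, 'm, 'e) cat_scheme \<Rightarrow> 'o \<Rightarrow> 'o \<Rightarrow> 'm set" where
  "Hom C x y = {f \<in> arr C. src C f = x \<and> tgt C f = y}"

locale category =
  fixes C :: "('o, 'm, 'e) cat_scheme" (structure)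
  assumes src_obj: "f \<in> arr C \<Longrightarrow> src C f \<in> obj C"
    and tgt_obj: "f \<in> arr C \<Longrightarrow> tgt C f \<in> obj C"
    and idm_Hom: "x \<in> obj C \<Longrightarrow> idm C x \<in> Hom C x x"
    and cmp_Hom: "\<lbrakk>f \<in> Hom C x y; g \<in> Hom C y z\<rbrakk> \<Longrightarrow> g \<cdot> f \<in> Hom C x z"
    and cmp_idm_left: "f \<in> Hom C x y \<Longrightarrow> idm C y \<cdot> f = f"
    and cmp_idm_right: "f \<in> Hom C x y \<Longrightarrow> f \<cdot> idm C x = f"
    and cmp_assoc: "\<lbrakk>f \<in> Hom C w x; g \<in> Hom C x y; h \<in> Hom C y z\<rbrakk>
                      \<Longrightarrow> (h \<cdot> g) \<cdot> f = h \<cdot> (g \<cdot> f)"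

definition is_iso :: "('o, 'm, 'e) cat_scheme \<Rightarrow> 'm \<Rightarrow> bool" where
  "is_iso C f \<longleftrightarrow> f \<in> arr C \<and>
     (\<exists>g \<in> Hom C (tgt C f) (src C f).
        g \<cdot>\<^bsub>C\<^esub> f = idm C (src C f) \<and> f \<cdot>\<^bsub>C\<^esub> g = idm C (tgt C f))"

definition isomorphic :: "('o, 'm, 'e) cat_scheme \<Rightarrow> 'o \<Rightarrow> 'o \<Rightarrow> bool" where
  "isomorphic C x y \<longleftrightarrow> (\<exists>f \<in> Hom C x y. is_iso C f)"

definition iso_closure :: "('o, 'm, 'e) cat_scheme \<Rightarrow> 'o set \<Rightarrow> 'o set" where
  "iso_closure C A = {y \<in> obj C. \<exists>x \<in> A. isomorphic C x y}"

definition zero_obj :: "('o, 'm, 'e) cat_scheme \<Rightarrow> 'o \<Rightarrow> bool" where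
  "zero_obj C z \<longleftrightarrow> z \<in> obj C \<and>
     (\<forall>x \<in> obj C. (\<exists>!f. f \<in> Hom C x z) \<and> (\<exists>!f. f \<in> Hom C z x))"

section \<open>Additive categories\<close>

record ('o, 'm) additive_cat = "('o, 'm) cat" +
  arr_add :: "'m \<Rightarrow> 'm \<Rightarrow> 'm"
  arr_zero :: "'o \<Rightarrow> 'o \<Rightarrow> 'm"

definition hom_group ::
    "('o, 'm, 'e) additive_cat_scheme \<Rightarrow> 'o \<Rightarrow> 'o \<Rightarrow> 'm monoid" where
  "hom_group C x y = \<lparr>carrier = Hom C x y, monoid.mult = arr_add C, one = arr_zero C x y\<rparr>"

definition arr_neg :: "('o, 'm, 'e) additive_cat_scheme \<Rightarrow> 'm \<Rightarrow> 'm" where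
  "arr_neg C f = inv\<^bsub>hom_group C (src C f) (tgt C f)\<^esub> f"

definition biproduct ::
    "('o, 'm, 'e) additive_cat_scheme \<Rightarrow> 'o \<Rightarrow> 'o \<Rightarrow> 'o \<Rightarrow> bool" where
  "biproduct C x y b \<longleftrightarrow>
     (\<exists>i \<in> Hom C x b. \<exists>j \<in> Hom C y b. \<exists>p \<in> Hom C b x. \<exists>r \<in> Hom C b y.
        p \<cdot>\<^bsub>C\<^esub> i = idm C x \<and> r \<cdot>\<^bsub>C\<^esub> j = idm C y \<and>
        p \<cdot>\<^bsub>C\<^esub> j = arr_zero C y x \<and> r \<cdot>\<^bsub>C\<^esub> i = arr_zero C x y \<and>
        arr_add C (i \<cdot>\<^bsub>C\<^esub> p) (j \<cdot>\<^bsub>C\<^esub> r) = idm C b)"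

locale additive_category = category C
  for C :: "('o, 'm, 'e) additive_cat_scheme" (structure) +
  assumes hom_comm_group: "\<lbrakk>x \<in> obj C; y \<in> obj C\<rbrakk> \<Longrightarrow> comm_group (hom_group C x y)"
    and cmp_add_left: "\<lbrakk>f \<in> Hom C x y; g \<in> Hom C y z; g' \<in> Hom C y z\<rbrakk>
          \<Longrightarrow> arr_add C g g' \<cdot> f = arr_add C (g \<cdot> f) (g' \<cdot> f)"
    and cmp_add_right: "\<lbrakk>f \<in> Hom C x y; f' \<in> Hom C x y; g \<in> Hom C y z\<rbrakk>
          \<Longrightarrow> g \<cdot> arr_add C f f' = arr_add C (g \<cdot> f) (g \<cdot> f')"
    and ex_zero_obj: "\<exists>z. zero_obj C z"
    and ex_biproduct: "\<lbrakk>x \<in> obj C; y \<in> obj C\<rbrakk> \<Longrightarrow> \<exists>b \<in> obj C. biproduct C x y b"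

section \<open>Triangulated categories\<close>

text \<open>A triple \<open>(f, g, h)\<close> in \<open>triangles C\<close> stands for the distinguished triangle
  \<open>x \<rightarrow> y \<rightarrow> z \<rightarrow> x[1]\<close> with these three maps.\<close>

record ('o, 'm) triangulated_cat = "('o, 'm) additive_cat" +
  shift_obj :: "'o \<Rightarrow> 'o"
  shift_arr :: "'m \<Rightarrow> 'm"
  triangles :: "('m \<times> 'm \<times> 'm) set"

text \<open>The shift is only required to be an additive autoequivalence; the case of an
  automorphism is included.  The octahedral axiom is stated for the triangles
  \<open>x \<rightarrow> y \<rightarrow> u\<close>, \<open>y \<rightarrow> z \<rightarrow> w\<close> and \<open>x \<rightarrow> z \<rightarrow> v\<close> on \<open>f\<close>, \<open>g\<close> and \<open>g \<cdot> f\<close>, and yields a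
  triangle \<open>u \<rightarrow> v \<rightarrow> w \<rightarrow> u[1]\<close>.\<close>

locale triangulated_category = additive_category C
  for C :: "('o, 'm, 'e) triangulated_cat_scheme" (structure) +
  assumes shift_obj: "x \<in> obj C \<Longrightarrow> shift_obj C x \<in> obj C"
    and shift_bij: "\<lbrakk>x \<in> obj C; y \<in> obj C\<rbrakk> \<Longrightarrow>
          bij_betw (shift_arr C) (Hom C x y) (Hom C (shift_obj C x) (shift_obj C y))"
    and shift_idm: "x \<in> obj C \<Longrightarrow> shift_arr C (idm C x) = idm C (shift_obj C x)"
    and shift_cmp: "\<lbrakk>f \<in> Hom C x y; g \<in> Hom C y z\<rbrakk>
          \<Longrightarrow> shift_arr C (g \<cdot> f) = shift_arr C g \<cdot> shift_arr C f"
    and shift_add: "\<lbrakk>f \<in> Hom C x y; g \<in> Hom C x y\<rbrakk>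
          \<Longrightarrow> shift_arr C (arr_add C f g) = arr_add C (shift_arr C f) (shift_arr C g)"
    and shift_ess_surj: "y \<in> obj C \<Longrightarrow> \<exists>x \<in> obj C. isomorphic C (shift_obj C x) y"
    and triangle_shape: "(f, g, h) \<in> triangles C \<Longrightarrow>
          \<exists>x y z. f \<in> Hom C x y \<and> g \<in> Hom C y z \<and> h \<in> Hom C z (shift_obj C x)"
    and triangle_idm: "\<lbrakk>x \<in> obj C; zero_obj C z\<rbrakk> \<Longrightarrow>
          (idm C x, arr_zero C x z, arr_zero C z (shift_obj C x)) \<in> triangles C"
    and triangle_complete: "f \<in> arr C \<Longrightarrow> \<exists>g h. (f, g, h) \<in> triangles C"
    and triangle_iso_closed:
      "\<lbrakk>(f, g, h) \<in> triangles C;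
        f' \<in> Hom C x' y'; g' \<in> Hom C y' z'; h' \<in> Hom C z' (shift_obj C x');
        a \<in> Hom C (src C f) x'; b \<in> Hom C (tgt C f) y'; c \<in> Hom C (tgt C g) z';
        is_iso C a; is_iso C b; is_iso C c;
        b \<cdot> f = f' \<cdot> a; c \<cdot> g = g' \<cdot> b; shift_arr C a \<cdot> h = h' \<cdot> c\<rbrakk>
       \<Longrightarrow> (f', g', h') \<in> triangles C"
    and triangle_rotate:
      "\<lbrakk>f \<in> Hom C x y; g \<in> Hom C y z; h \<in> Hom C z (shift_obj C x)\<rbrakk> \<Longrightarrow>
        (f, g, h) \<in> triangles C \<longleftrightarrow> (g, h, arr_neg C (shift_arr C f)) \<in> triangles C"
    and triangle_map:
      "\<lbrakk>(f, g, h) \<in> triangles C; (f', g', h') \<in> triangles C;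
        a \<in> Hom C (src C f) (src C f'); b \<in> Hom C (tgt C f) (tgt C f');
        b \<cdot> f = f' \<cdot> a\<rbrakk>
       \<Longrightarrow> \<exists>c \<in> Hom C (tgt C g) (tgt C g'). c \<cdot> g = g' \<cdot> b \<and> shift_arr C a \<cdot> h = h' \<cdot> c"
    and octahedral:
      "\<lbrakk>f \<in> Hom C x y; g \<in> Hom C y z;
        (f, f', f'') \<in> triangles C; (g, g', g'') \<in> triangles C;
        (g \<cdot> f, k', k'') \<in> triangles C\<rbrakk>
       \<Longrightarrow> \<exists>a \<in> Hom C (tgt C f') (tgt C k'). \<exists>b \<in> Hom C (tgt C k') (tgt C g').
             (a, b, shift_arr C f' \<cdot> g'') \<in> triangles C \<and>
             a \<cdot> f' = k' \<cdot> g \<and> k'' \<cdot> a = f'' \<and>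
             b \<cdot> k' = g' \<and> g'' \<cdot> b = shift_arr C f \<cdot> k''"

section \<open>Grothendieck group\<close>

definition K_relations ::
    "('o, 'm, 'e) triangulated_cat_scheme \<Rightarrow> ('o \<Rightarrow>\<^sub>0 int) set" where
  "K_relations C = generate (free_Abelian_group (obj C))
     {frag_of (tgt C f) - frag_of (src C f) - frag_of (tgt C g) | f g h.
        (f, g, h) \<in> triangles C}"

definition K_group ::
    "('o, 'm, 'e) triangulated_cat_scheme \<Rightarrow> ('o \<Rightarrow>\<^sub>0 int) set monoid" where
  "K_group C = free_Abelian_group (obj C) Mod K_relations C"

definition K_class ::
    "('o, 'm, 'e) triangulated_cat_scheme \<Rightarrow> 'o \<Rightarrow> ('o \<Rightarrow>\<^sub>0 int) set" where
  "K_class C x = K_relations C #>\<^bsub>free_Abelian_group (obj C)\<^esub> frag_of x"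

definition complex_group :: "complex monoid" where
  "complex_group = \<lparr>carrier = UNIV, monoid.mult = (+), one = 0\<rparr>"

section \<open>Full subcategories\<close>

text \<open>A set \<open>A\<close> of objects stands for the full subcategory on \<open>A\<close>.  Monomorphisms, kernels
  and cokernels are taken inside this subcategory, not in \<open>C\<close>.\<close>

definition monic_in :: "('o, 'm, 'e) cat_scheme \<Rightarrow> 'o set \<Rightarrow> 'm \<Rightarrow> bool" where
  "monic_in C A f \<longleftrightarrow> f \<in> arr C \<and> src C f \<in> A \<and> tgt C f \<in> A \<and>
     (\<forall>w \<in> A. \<forall>g \<in> Hom C w (src C f). \<forall>h \<in> Hom C w (src C f).
        f \<cdot>\<^bsub>C\<^esub> g = f \<cdot>\<^bsub>C\<^esub> h \<longrightarrow> g = h)"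

definition simple_in :: "('o, 'm, 'e) cat_scheme \<Rightarrow> 'o set \<Rightarrow> 'o \<Rightarrow> bool" where
  "simple_in C A x \<longleftrightarrow> x \<in> A \<and> \<not> zero_obj C x \<and>
     (\<forall>f. monic_in C A f \<and> tgt C f = x \<longrightarrow> zero_obj C (src C f) \<or> is_iso C f)"

definition kernel_in ::
    "('o, 'm, 'e) additive_cat_scheme \<Rightarrow> 'o set \<Rightarrow> 'm \<Rightarrow> 'm \<Rightarrow> bool" where
  "kernel_in C A g f \<longleftrightarrow> f \<in> arr C \<and> g \<in> arr C \<and>
     src C f \<in> A \<and> tgt C f \<in> A \<and> tgt C g \<in> A \<and> src C g = tgt C f \<and>
     g \<cdot>\<^bsub>C\<^esub> f = arr_zero C (src C f) (tgt C g) \<and>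
     (\<forall>w \<in> A. \<forall>h \<in> Hom C w (src C g). g \<cdot>\<^bsub>C\<^esub> h = arr_zero C w (tgt C g) \<longrightarrow>
        (\<exists>!k. k \<in> Hom C w (src C f) \<and> f \<cdot>\<^bsub>C\<^esub> k = h))"

definition cokernel_in ::
    "('o, 'm, 'e) additive_cat_scheme \<Rightarrow> 'o set \<Rightarrow> 'm \<Rightarrow> 'm \<Rightarrow> bool" where
  "cokernel_in C A f g \<longleftrightarrow> f \<in> arr C \<and> g \<in> arr C \<and>
     src C f \<in> A \<and> tgt C f \<in> A \<and> tgt C g \<in> A \<and> src C g = tgt C f \<and>
     g \<cdot>\<^bsub>C\<^esub> f = arr_zero C (src C f) (tgt C g) \<and>
     (\<forall>w \<in> A. \<forall>h \<in> Hom C (tgt C f) w. h \<cdot>\<^bsub>C\<^esub> f = arr_zero C (src C f) w \<longrightarrow>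
        (\<exists>!k. k \<in> Hom C (tgt C g) w \<and> k \<cdot>\<^bsub>C\<^esub> g = h))"

text \<open>In a quasi-abelian category, the strict monomorphisms are the kernels of their cokernels.\<close>

definition strict_monic_in ::
    "('o, 'm, 'e) additive_cat_scheme \<Rightarrow> 'o set \<Rightarrow> 'm \<Rightarrow> bool" where
  "strict_monic_in C A f \<longleftrightarrow> (\<exists>g. cokernel_in C A f g \<and> kernel_in C A g f)"

definition subobject_le :: "('o, 'm, 'e) cat_scheme \<Rightarrow> 'm \<Rightarrow> 'm \<Rightarrow> bool" where
  "subobject_le C f g \<longleftrightarrow> (\<exists>k \<in> Hom C (src C f) (src C g). f = g \<cdot>\<^bsub>C\<^esub> k)"

text \<open>Every ascending chain and every descending chain of strict subobjects of an object
  stabilises.\<close>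

definition finite_length ::
    "('o, 'm, 'e) additive_cat_scheme \<Rightarrow> 'o set \<Rightarrow> bool" where
  "finite_length C A \<longleftrightarrow>
     (\<forall>x \<in> A. \<forall>s :: nat \<Rightarrow> 'm.
        (\<forall>i. strict_monic_in C A (s i) \<and> tgt C (s i) = x) \<and>
        ((\<forall>i. subobject_le C (s i) (s (Suc i))) \<or> (\<forall>i. subobject_le C (s (Suc i)) (s i)))
        \<longrightarrow> (\<exists>N. \<forall>i \<ge> N. subobject_le C (s i) (s N) \<and> subobject_le C (s N) (s i)))"

section \<open>Slicings and stability conditions\<close>

text \<open>\<open>x\<close> has the filtration \<open>0 = E 0 \<rightarrow> E 1 \<rightarrow> \<dots> \<rightarrow> E n = x\<close>, with semistable (hence
  non-zero) factors \<open>A 0, \<dots>, A (n - 1)\<close> of phases \<open>\<phi> 0 > \<dots> > \<phi> (n - 1)\<close>.\<close>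

definition HN_filtration ::
    "('o, 'm, 'e) triangulated_cat_scheme \<Rightarrow> (real \<Rightarrow> 'o set) \<Rightarrow> 'o \<Rightarrow>
     nat \<Rightarrow> (nat \<Rightarrow> 'o) \<Rightarrow> (nat \<Rightarrow> 'o) \<Rightarrow> (nat \<Rightarrow> real) \<Rightarrow> bool" where
  "HN_filtration C P x n E A \<phi> \<longleftrightarrow>
     zero_obj C (E 0) \<and> E n = x \<and>
     (\<forall>i j. i < j \<and> j < n \<longrightarrow> \<phi> i > \<phi> j) \<and>
     (\<forall>i < n. A i \<in> P (\<phi> i) \<and> \<not> zero_obj C (A i) \<and>
        (\<exists>f g h. (f, g, h) \<in> triangles C \<and>
           f \<in> Hom C (E i) (E (Suc i)) \<and> g \<in> Hom C (E (Suc i)) (A i)))"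

text \<open>Each \<open>P \<phi>\<close> is a full additive subcategory, closed under isomorphisms as usual.\<close>

definition slicing ::
    "('o, 'm, 'e) triangulated_cat_scheme \<Rightarrow> (real \<Rightarrow> 'o set) \<Rightarrow> bool" where
  "slicing C P \<longleftrightarrow>
     (\<forall>\<phi>. P \<phi> \<subseteq> obj C \<and> iso_closure C (P \<phi>) \<subseteq> P \<phi> \<and> (\<forall>z. zero_obj C z \<longrightarrow> z \<in> P \<phi>) \<and>
        (\<forall>x \<in> P \<phi>. \<forall>y \<in> P \<phi>. \<forall>b \<in> obj C. biproduct C x y b \<longrightarrow> b \<in> P \<phi>)) \<and>
     (\<forall>\<phi>. P (\<phi> + 1) = iso_closure C (shift_obj C ` P \<phi>)) \<and>
     (\<forall>\<phi> \<psi>. \<phi> > \<psi> \<longrightarrow>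
        (\<forall>x \<in> P \<phi>. \<forall>y \<in> P \<psi>. Hom C x y = {arr_zero C x y})) \<and>
     (\<forall>x \<in> obj C. \<not> zero_obj C x \<longrightarrow> (\<exists>n E A \<phi>. HN_filtration C P x n E A \<phi>))"

text \<open>The extension-closed subcategory generated by the \<open>P \<phi>\<close> with \<open>\<phi> \<in> I\<close>.\<close>

inductive_set slice ::
    "('o, 'm, 'e) triangulated_cat_scheme \<Rightarrow> (real \<Rightarrow> 'o set) \<Rightarrow> real set \<Rightarrow> 'o set"
  for C P I where
    base: "\<lbrakk>\<phi> \<in> I; x \<in> P \<phi>\<rbrakk> \<Longrightarrow> x \<in> slice C P I"
  | ext: "\<lbrakk>(f, g, h) \<in> triangles C; f \<in> Hom C x y; g \<in> Hom C y z;
           x \<in> slice C P I; z \<in> slice C P I\<rbrakk> \<Longrightarrow> y \<in> slice C P I"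

text \<open>The bound on \<open>\<eta>\<close> makes the interval shorter than 1, so that the subcategory is
  quasi-abelian; the condition for some \<open>\<eta>\<close> implies it for all smaller ones.\<close>

definition locally_finite ::
    "('o, 'm, 'e) triangulated_cat_scheme \<Rightarrow> (real \<Rightarrow> 'o set) \<Rightarrow> bool" where
  "locally_finite C P \<longleftrightarrow>
     (\<exists>\<eta>. 0 < \<eta> \<and> \<eta> < 1 / 2 \<and> (\<forall>t. finite_length C (slice C P {t - \<eta> <..< t + \<eta>})))"

type_synonym 'o stability = "(real \<Rightarrow> 'o set) \<times> (('o \<Rightarrow>\<^sub>0 int) set \<Rightarrow> complex)"

text \<open>The central charge is extensional, so that equality of pairs \<open>(P, Z)\<close> means equality of
  \<open>Z\<close> on the Grothendieck group.\<close>

definition Stab :: "('o, 'm, 'e) triangulated_cat_scheme \<Rightarrow> 'o stability set" where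
  "Stab C = {(P, Z). slicing C P \<and> locally_finite C P \<and>
     Z \<in> hom (K_group C) complex_group \<and> Z \<in> extensional (carrier (K_group C)) \<and>
     (\<forall>\<phi>. \<forall>x \<in> P \<phi>. \<not> zero_obj C x \<longrightarrow>
        (\<exists>r > 0. Z (K_class C x) = complex_of_real r * exp (\<i> * pi * \<phi>)))}"

definition stable_obj ::
    "('o, 'm, 'e) triangulated_cat_scheme \<Rightarrow> 'o stability \<Rightarrow> real \<Rightarrow> 'o \<Rightarrow> bool" where
  "stable_obj C \<tau> \<phi> x \<longleftrightarrow> simple_in C (fst \<tau> \<phi>) x"

definition stab_act ::
    "('o, 'm, 'e) triangulated_cat_scheme \<Rightarrow> complex \<Rightarrow> 'o stability \<Rightarrow> 'o stability" where
  "stab_act C \<omega> \<tau> =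
     (\<lambda>\<phi>. fst \<tau> (\<phi> - Im \<omega> / pi), \<lambda>k \<in> carrier (K_group C). exp \<omega> * snd \<tau> k)"

definition stab_rel ::
    "('o, 'm, 'e) triangulated_cat_scheme \<Rightarrow> ('o stability \<times> 'o stability) set" where
  "stab_rel C = {(\<sigma>, \<tau>). \<sigma> \<in> Stab C \<and> \<tau> \<in> Stab C \<and> (\<exists>\<omega>. \<tau> = stab_act C \<omega> \<sigma>)}"

definition Stab_mod :: "('o, 'm, 'e) triangulated_cat_scheme \<Rightarrow> 'o stability set set" where
  "Stab_mod C = Stab C // stab_rel C"

section \<open>Masses\<close>

definition mass ::
    "('o, 'm, 'e) triangulated_cat_scheme \<Rightarrow> real \<Rightarrow> 'o stability \<Rightarrow> 'o \<Rightarrow> real" where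
  "mass C q \<tau> x = (THE m. \<exists>n E A \<phi>. HN_filtration C (fst \<tau>) x n E A \<phi> \<and>
     m = (\<Sum>i<n. q powr \<phi> i * cmod (snd \<tau> (K_class C (A i)))))"

text \<open>Functions \<open>S \<rightarrow> \<real>\<close> are represented by extensional functions.\<close>

definition nonzero_funs :: "'o set \<Rightarrow> ('o \<Rightarrow> real) set" where
  "nonzero_funs S = {f \<in> S \<rightarrow>\<^sub>E UNIV. \<exists>x \<in> S. f x \<noteq> 0}"

definition proj_rel :: "'o set \<Rightarrow> (('o \<Rightarrow> real) \<times> ('o \<Rightarrow> real)) set" where
  "proj_rel S = {(f, g). f \<in> nonzero_funs S \<and> g \<in> nonzero_funs S \<and>
     (\<exists>c. c \<noteq> 0 \<and> g = (\<lambda>x \<in> S. c * f x))}"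

definition proj_space :: "'o set \<Rightarrow> ('o \<Rightarrow> real) set set" where
  "proj_space S = nonzero_funs S // proj_rel S"

text \<open>The map \<open>[\<tau>] \<mapsto> [m\<^bsub>q,\<tau>\<^esub>]\<close> on orbits; all members of an orbit give the same point of
  \<open>proj_space S\<close>, so the union is that point.\<close>

definition mass_map ::
    "('o, 'm, 'e) triangulated_cat_scheme \<Rightarrow> 'o set \<Rightarrow> real \<Rightarrow> 'o stability set
     \<Rightarrow> ('o \<Rightarrow> real) set" where
  "mass_map C S q X = (\<Union>\<tau> \<in> X. proj_rel S `` {\<lambda>x \<in> S. mass C q \<tau> x})"

end

theory Submission
  imports Defs
begin

text \<open>
  Let \<open>\<sigma>\<close> and \<open>\<tau>\<close> have proportional masses on \<open>S\<close> for two parameters \<open>q \<noteq> q'\<close>.  Fix a phase \<open>\<phi>\<close>.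
  The real linear functional \<open>l\<close> on the complex numbers whose value on the ray of phase \<open>t\<close> is
  \<open>q\<^sup>\<phi> (cos \<pi>(t - \<phi>) + (ln q / \<pi>) sin \<pi>(t - \<phi>))\<close> is tangent at \<open>t = \<phi>\<close> to \<open>q\<^sup>t\<close> and lies strictly below
  it elsewhere on \<open>\<bar>t - \<phi>\<bar> < 1\<close>.  It is nonnegative on the heart \<open>P (s, s + 1]\<close>, where \<open>s, s + 1\<close> are the
  phases next to \<open>\<phi>\<close> at which it vanishes, so \<open>N y = l (Z (H y))\<close>, with \<open>H\<close> the cohomology functor of
  this heart, is subadditive on triangles, is at most the mass, and equals the mass exactly on \<open>P \<phi>\<close>.

  Let \<open>x\<close> be \<open>\<sigma>\<close>-stable of phase \<open>\<phi>\<close>, and refine its Harder--Narasimhan filtration for \<open>\<tau>\<close> to one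
  with \<open>\<tau>\<close>-stable factors \<open>s\<^sub>j\<close>.  As \<open>x\<close> and all \<open>s\<^sub>j\<close> lie in \<open>S\<close>, the \<open>\<sigma>\<close>-mass of \<open>x\<close> is the sum of the
  \<open>\<sigma>\<close>-masses of the \<open>s\<^sub>j\<close>, hence at least the sum of the \<open>N s\<^sub>j\<close>, hence at least \<open>N x\<close>, which is the
  \<open>\<sigma>\<close>-mass of \<open>x\<close>.  So every \<open>s\<^sub>j\<close> is \<open>\<sigma>\<close>-semistable of phase \<open>\<phi>\<close>.  Comparing the two proportionality
  factors on \<open>s\<^sub>j\<close> shows that its \<open>\<tau>\<close>-phase is \<open>\<phi> + b\<close> with \<open>b\<close> independent of \<open>j\<close>, \<open>x\<close> and \<open>\<phi>\<close>; hence
  \<open>P\<^sub>\<sigma> \<phi> \<subseteq> P\<^sub>\<tau> (\<phi> + b)\<close>, and equality follows by symmetry.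
\<close>

section \<open>Additive and triangulated categories\<close>

context additive_category
begin

section \<open>Hom groups and bilinear composition\<close>

lemma Hom_obj: "f \<in> Hom C x y \<Longrightarrow> x \<in> obj C" "f \<in> Hom C x y \<Longrightarrow> y \<in> obj C"
  using src_obj tgt_obj by (auto simp: Hom_def)

lemma Hom_arr: "f \<in> Hom C x y \<Longrightarrow> f \<in> arr C" 
  and Hom_src: "f \<in> Hom C x y \<Longrightarrow> src C f = x"
  and Hom_tgt: "f \<in> Hom C x y \<Longrightarrow> tgt C f = y"
  by (auto simp: Hom_def)

lemma arr_zero_Hom: "\<lbrakk>x \<in> obj C; y \<in> obj C\<rbrakk> \<Longrightarrow> arr_zero C x y \<in> Hom C x y"
proof -
  assume "x \<in> obj C" "y \<in> obj C"
  then interpret G: comm_group "hom_group C x y" by (rule hom_comm_group)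
  show ?thesis using G.one_closed by (simp add: hom_group_def)
qed

lemma arr_add_Hom:
  assumes "f \<in> Hom C x y" "g \<in> Hom C x y"
  shows "arr_add C f g \<in> Hom C x y"
proof -
  interpret G: comm_group "hom_group C x y" using assms Hom_obj hom_comm_group by blast
  show ?thesis using G.m_closed[of f g] assms by (simp add: hom_group_def)
qed

lemma arr_neg_Hom:
  assumes "f \<in> Hom C x y"
  shows "arr_neg C f \<in> Hom C x y"
proof -
  interpret G: comm_group "hom_group C x y" using assms Hom_obj hom_comm_group by blast
  show ?thesis using G.inv_closed[of f] assms by (simp add: hom_group_def arr_neg_def Hom_def)
qed

lemma arr_add_neg:
  assumes "f \<in> Hom C x y"
  shows "arr_add C f (arr_neg C f) = arr_zero C x y"
proof -
  interpret G: comm_group "hom_group C x y" using assms Hom_obj hom_comm_group by blast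
  show ?thesis using G.r_inv[of f] assms by (simp add: hom_group_def arr_neg_def Hom_def)
qed

lemma arr_add_zero:
  assumes "f \<in> Hom C x y"
  shows "arr_add C f (arr_zero C x y) = f"
proof -
  interpret G: comm_group "hom_group C x y" using assms Hom_obj hom_comm_group by blast
  show ?thesis using G.r_one[of f] assms by (simp add: hom_group_def)
qed

lemma arr_add_cancel:
  assumes "f \<in> Hom C x y" "g \<in> Hom C x y" "h \<in> Hom C x y" "arr_add C f g = arr_add C f h"
  shows "g = h"
proof -
  interpret G: comm_group "hom_group C x y" using assms Hom_obj hom_comm_group by blast
  show ?thesis using G.Units_l_cancel[of f g h] G.Units_eq assms by (simp add: hom_group_def)
qed

lemma arr_neg_unique:
  assumes "f \<in> Hom C x y" "g \<in> Hom C x y" "arr_add C f g = arr_zero C x y"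
  shows "g = arr_neg C f"
  using arr_add_cancel[OF assms(1,2) arr_neg_Hom[OF assms(1)]] arr_add_neg[OF assms(1)] assms(3)
  by simp

lemma arr_add_commute:
  assumes "f \<in> Hom C x y" "g \<in> Hom C x y"
  shows "arr_add C f g = arr_add C g f"
proof -
  interpret G: comm_group "hom_group C x y" using assms Hom_obj hom_comm_group by blast
  show ?thesis using G.m_comm[of f g] assms by (simp add: hom_group_def)
qed

lemma arr_neg_neg: "f \<in> Hom C x y \<Longrightarrow> arr_neg C (arr_neg C f) = f"
  by (metis arr_add_commute arr_add_neg arr_neg_Hom arr_neg_unique)

lemma arr_eqI:
  assumes "f \<in> Hom C x y" "g \<in> Hom C x y" "arr_add C f (arr_neg C g) = arr_zero C x y"
  shows "f = g"
  by (metis arr_neg_neg arr_neg_unique arr_neg_Hom assms)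

lemma arr_neg_zero: "\<lbrakk>x \<in> obj C; y \<in> obj C\<rbrakk> \<Longrightarrow> arr_neg C (arr_zero C x y) = arr_zero C x y"
  by (metis arr_add_zero arr_neg_unique arr_zero_Hom)

lemma cmp_zero_left:
  assumes "f \<in> Hom C x y" "z \<in> obj C"
  shows "arr_zero C y z \<cdot> f = arr_zero C x z"
proof -
  have z: "arr_zero C y z \<in> Hom C y z" using assms Hom_obj arr_zero_Hom by blast
  have c: "arr_zero C y z \<cdot> f \<in> Hom C x z" using cmp_Hom assms z by blast
  have o: "arr_zero C x z \<in> Hom C x z" using assms Hom_obj arr_zero_Hom by blast
  have "arr_add C (arr_zero C y z \<cdot> f) (arr_zero C y z \<cdot> f) = arr_zero C y z \<cdot> f"
    using cmp_add_left[OF assms(1) z z] arr_add_zero[OF z] by simp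
  then show ?thesis using arr_add_cancel[OF c c o] arr_add_zero[OF c] by simp
qed

lemma cmp_zero_right:
  assumes "f \<in> Hom C y z" "x \<in> obj C"
  shows "f \<cdot> arr_zero C x y = arr_zero C x z"
proof -
  have z: "arr_zero C x y \<in> Hom C x y" using assms Hom_obj arr_zero_Hom by blast
  have c: "f \<cdot> arr_zero C x y \<in> Hom C x z" using cmp_Hom assms z by blast
  have o: "arr_zero C x z \<in> Hom C x z" using assms Hom_obj arr_zero_Hom by blast
  have "arr_add C (f \<cdot> arr_zero C x y) (f \<cdot> arr_zero C x y) = f \<cdot> arr_zero C x y"
    using cmp_add_right[OF z z assms(1)] arr_add_zero[OF z] by simp
  then show ?thesis using arr_add_cancel[OF c c o] arr_add_zero[OF c] by simp
qed

lemma cmp_neg_left: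
  assumes "f \<in> Hom C x y" "g \<in> Hom C y z"
  shows "arr_neg C g \<cdot> f = arr_neg C (g \<cdot> f)"
proof (rule arr_neg_unique)
  show "g \<cdot> f \<in> Hom C x z" "arr_neg C g \<cdot> f \<in> Hom C x z"
    using assms cmp_Hom arr_neg_Hom by blast+
  show "arr_add C (g \<cdot> f) (arr_neg C g \<cdot> f) = arr_zero C x z"
    using cmp_add_left[OF assms arr_neg_Hom[OF assms(2)]] arr_add_neg[OF assms(2)]
      cmp_zero_left assms Hom_obj by metis
qed

lemma cmp_neg_right:
  assumes "f \<in> Hom C x y" "g \<in> Hom C y z"
  shows "g \<cdot> arr_neg C f = arr_neg C (g \<cdot> f)"
proof (rule arr_neg_unique)
  show "g \<cdot> f \<in> Hom C x z" "g \<cdot> arr_neg C f \<in> Hom C x z"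
    using assms cmp_Hom arr_neg_Hom by blast+
  show "arr_add C (g \<cdot> f) (g \<cdot> arr_neg C f) = arr_zero C x z"
    using cmp_add_right[OF assms(1) arr_neg_Hom[OF assms(1)] assms(2)] arr_add_neg[OF assms(1)]
      cmp_zero_right assms Hom_obj by metis
qed

lemma neg_eq_zero: "\<lbrakk>f \<in> Hom C x y; arr_neg C f = arr_zero C x y\<rbrakk> \<Longrightarrow> f = arr_zero C x y"
  by (metis Hom_obj arr_neg_neg arr_neg_zero)

section \<open>Zero objects, vanishing Hom sets and isomorphisms\<close>

lemma zero_obj_iff: "zero_obj C z \<longleftrightarrow> z \<in> obj C \<and> idm C z = arr_zero C z z"
proof
  assume "zero_obj C z"
  then show "z \<in> obj C \<and> idm C z = arr_zero C z z"
    using arr_zero_Hom idm_Hom unfolding zero_obj_def by blast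
next
  assume z: "z \<in> obj C \<and> idm C z = arr_zero C z z"
  have "f = arr_zero C x z" if "f \<in> Hom C x z" for f x
    using cmp_idm_left[OF that] cmp_zero_left[OF that] z by simp
  moreover have "f = arr_zero C z x" if "f \<in> Hom C z x" for f x
    using cmp_idm_right[OF that] cmp_zero_right[OF that] z by simp
  ultimately show "zero_obj C z"
    unfolding zero_obj_def using z arr_zero_Hom by blast
qed

lemma zero_obj_obj: "zero_obj C z \<Longrightarrow> z \<in> obj C"
  by (simp add: zero_obj_def)

definition orth :: "'o \<Rightarrow> 'o \<Rightarrow> bool" where
  "orth x y \<longleftrightarrow> x \<in> obj C \<and> y \<in> obj C \<and> (\<forall>f \<in> Hom C x y. f = arr_zero C x y)"

lemma orth_zero_left: "\<lbrakk>zero_obj C z; x \<in> obj C\<rbrakk> \<Longrightarrow> orth z x"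
  unfolding orth_def zero_obj_def using arr_zero_Hom by blast

lemma is_isoI:
  assumes "f \<in> Hom C x y" "g \<in> Hom C y x" "g \<cdot> f = idm C x" "f \<cdot> g = idm C y"
  shows "is_iso C f"
  using assms unfolding is_iso_def by (auto simp: Hom_def)

lemma is_isoE:
  assumes "is_iso C f" "f \<in> Hom C x y"
  obtains g where "g \<in> Hom C y x" "g \<cdot> f = idm C x" "f \<cdot> g = idm C y" "is_iso C g"
proof -
  obtain g where "g \<in> Hom C y x" "g \<cdot> f = idm C x" "f \<cdot> g = idm C y"
    using assms(1) Hom_src[OF assms(2)] Hom_tgt[OF assms(2)] unfolding is_iso_def by blast
  then show ?thesis using that is_isoI assms(2) by blast
qed

lemma is_iso_idm: "x \<in> obj C \<Longrightarrow> is_iso C (idm C x)"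
  using is_isoI idm_Hom cmp_idm_left by metis

lemma isomorphic_refl: "x \<in> obj C \<Longrightarrow> isomorphic C x x"
  unfolding isomorphic_def using is_iso_idm idm_Hom by blast

lemma isomorphic_sym: "isomorphic C x y \<Longrightarrow> isomorphic C y x"
  unfolding isomorphic_def by (meson is_isoE)

lemma zero_obj_isomorphic:
  assumes "isomorphic C x y" "zero_obj C x"
  shows "zero_obj C y"
proof -
  obtain f g where f: "f \<in> Hom C x y" "g \<in> Hom C y x" "f \<cdot> g = idm C y"
    using assms(1) unfolding isomorphic_def by (meson is_isoE)
  then have "f = arr_zero C x y"
    using orth_zero_left[OF assms(2)] Hom_obj unfolding orth_def by blast
  then show ?thesis
    using f cmp_zero_left Hom_obj zero_obj_iff by metis
qed

end

section \<open>Typed triangles, shift and rotation\<close>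

context triangulated_category
begin

text \<open>\<open>triangles C\<close> records three arrows only; this form also names the vertices,
  about which most later statements speak.\<close>

definition tri :: "'o \<Rightarrow> 'o \<Rightarrow> 'o \<Rightarrow> 'm \<Rightarrow> 'm \<Rightarrow> 'm \<Rightarrow> bool" where
  "tri x y z f g h \<longleftrightarrow> (f, g, h) \<in> triangles C \<and> f \<in> Hom C x y \<and> g \<in> Hom C y z
     \<and> h \<in> Hom C z (shift_obj C x)"

lemma triI:
  assumes "(f, g, h) \<in> triangles C" "f \<in> Hom C x y" "g \<in> Hom C y z"
  shows "tri x y z f g h"
proof -
  obtain x' y' z' where "f \<in> Hom C x' y'" "g \<in> Hom C y' z'" "h \<in> Hom C z' (shift_obj C x')"
    using triangle_shape[OF assms(1)] by blast
  then show ?thesis using assms unfolding tri_def Hom_def by auto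
qed

lemma tri_obj:
  assumes "tri x y z f g h"
  shows "x \<in> obj C" "y \<in> obj C" "z \<in> obj C"
  using assms Hom_obj unfolding tri_def by blast+

lemma ex_cone:
  assumes "f \<in> Hom C x y"
  obtains z g h where "tri x y z f g h"
proof -
  obtain g h where gh: "(f, g, h) \<in> triangles C" using triangle_complete Hom_arr assms by blast
  obtain x' y' z' where "f \<in> Hom C x' y'" "g \<in> Hom C y' z'" "h \<in> Hom C z' (shift_obj C x')"
    using triangle_shape[OF gh] by blast
  then show ?thesis using that gh assms unfolding tri_def Hom_def by auto
qed

lemma shift_Hom: "f \<in> Hom C x y \<Longrightarrow> shift_arr C f \<in> Hom C (shift_obj C x) (shift_obj C y)"
  using shift_bij[of x y] Hom_obj bij_betwE by blast

lemma shift_inj: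
  assumes "f \<in> Hom C x y" "g \<in> Hom C x y" "shift_arr C f = shift_arr C g"
  shows "f = g"
  using shift_bij[of x y] Hom_obj assms unfolding bij_betw_def inj_on_def by blast

lemma shift_full:
  assumes "f \<in> Hom C (shift_obj C x) (shift_obj C y)" "x \<in> obj C" "y \<in> obj C"
  obtains g where "g \<in> Hom C x y" "f = shift_arr C g"
  using shift_bij[of x y] assms unfolding bij_betw_def by blast

lemma shift_zero:
  assumes "x \<in> obj C" "y \<in> obj C"
  shows "shift_arr C (arr_zero C x y) = arr_zero C (shift_obj C x) (shift_obj C y)"
proof -
  let ?z = "arr_zero C x y" and ?w = "arr_zero C (shift_obj C x) (shift_obj C y)"
  have z: "?z \<in> Hom C x y" using assms arr_zero_Hom by blast
  have w: "?w \<in> Hom C (shift_obj C x) (shift_obj C y)" using assms arr_zero_Hom shift_obj by blast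
  have "arr_add C (shift_arr C ?z) (shift_arr C ?z) = arr_add C (shift_arr C ?z) ?w"
    using shift_add[OF z z] arr_add_zero[OF z] arr_add_zero[OF shift_Hom[OF z]] by simp
  then show ?thesis using arr_add_cancel shift_Hom[OF z] w by blast
qed

lemma shift_zero_obj: "zero_obj C z \<Longrightarrow> zero_obj C (shift_obj C z)"
  by (metis shift_idm shift_obj shift_zero zero_obj_iff)

lemma tri_rotate:
  "tri x y z f g h \<Longrightarrow> tri y z (shift_obj C x) g h (arr_neg C (shift_arr C f))"
  unfolding tri_def using triangle_rotate arr_neg_Hom shift_Hom by blast

lemma tri_rotate_back:
  assumes "f \<in> Hom C x y" "tri y z (shift_obj C x) g h (arr_neg C (shift_arr C f))"
  shows "tri x y z f g h"
  using assms triangle_rotate unfolding tri_def by blast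

lemma tri_idm: "\<lbrakk>x \<in> obj C; zero_obj C z\<rbrakk> \<Longrightarrow>
    tri x x z (idm C x) (arr_zero C x z) (arr_zero C z (shift_obj C x))"
  unfolding tri_def using triangle_idm idm_Hom arr_zero_Hom shift_obj zero_obj_obj by blast

lemma tri_idm_right:
  assumes "x \<in> obj C" "zero_obj C z"
  shows "tri z x x (arr_zero C z x) (idm C x) (arr_zero C x (shift_obj C z))"
proof (rule tri_rotate_back)
  have o: "z \<in> obj C" using assms zero_obj_obj by blast
  show "arr_zero C z x \<in> Hom C z x" using arr_zero_Hom assms o by blast
  show "tri x x (shift_obj C z) (idm C x) (arr_zero C x (shift_obj C z))
      (arr_neg C (shift_arr C (arr_zero C z x)))"
    using tri_idm[OF assms(1) shift_zero_obj[OF assms(2)]]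
    by (simp add: shift_zero arr_neg_zero shift_obj o assms)
qed

lemma tri_map:
  assumes "tri x y z f g h" "tri x' y' z' f' g' h'" "a \<in> Hom C x x'" "b \<in> Hom C y y'"
    "b \<cdot> f = f' \<cdot> a"
  obtains c where "c \<in> Hom C z z'" "c \<cdot> g = g' \<cdot> b" "shift_arr C a \<cdot> h = h' \<cdot> c"
proof -
  have "src C f = x" "src C f' = x'" "tgt C f = y" "tgt C f' = y'" "tgt C g = z" "tgt C g' = z'"
    using assms unfolding tri_def Hom_def by auto
  then show ?thesis
    using triangle_map[of f g h f' g' h' a b] assms that unfolding tri_def by metis
qed

section \<open>Exactness of Hom along a triangle\<close>

lemma exact_left:
  assumes "tri x y z f g h" "p \<in> Hom C w y" "g \<cdot> p = arr_zero C w z"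
  obtains k where "k \<in> Hom C w x" "f \<cdot> k = p"
proof -
  obtain o' where z: "zero_obj C o'" using ex_zero_obj by blast
  note ob = tri_obj[OF assms(1)] Hom_obj(1)[OF assms(2)] zero_obj_obj[OF z]
  have H: "f \<in> Hom C x y" "g \<in> Hom C y z" using assms(1) unfolding tri_def by auto
  have eq: "arr_zero C o' z \<cdot> arr_zero C w o' = g \<cdot> p"
    using assms(3) cmp_zero_left[OF arr_zero_Hom] ob by simp
  \<comment> \<open>A map of triangles is completed at the third vertex, so both triangles are
    rotated first: w -> 0 -> w[1] maps to y -> z -> x[1] and yields \<open>c\<close> from w[1] to
    x[1], which is then unshifted. The two minus signs cancel.\<close>
  obtain c where c: "c \<in> Hom C (shift_obj C w) (shift_obj C x)"
    "shift_arr C p \<cdot> arr_neg C (shift_arr C (idm C w)) = arr_neg C (shift_arr C f) \<cdot> c"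
    using tri_map[OF tri_rotate[OF tri_idm[OF ob(4) z]] tri_rotate[OF assms(1)] assms(2)
        arr_zero_Hom[OF ob(5,3)] eq] by metis
  obtain k where k: "k \<in> Hom C w x" "c = shift_arr C k" using shift_full[OF c(1) ob(4,1)] .
  have fk: "f \<cdot> k \<in> Hom C w y" using cmp_Hom k H by blast
  have sp: "shift_arr C p \<in> Hom C (shift_obj C w) (shift_obj C y)"
    and sf: "shift_arr C f \<in> Hom C (shift_obj C x) (shift_obj C y)"
    and sk: "shift_arr C k \<in> Hom C (shift_obj C w) (shift_obj C x)"
    using shift_Hom assms(2) H(1) k(1) by auto
  have "shift_arr C p \<cdot> arr_neg C (shift_arr C (idm C w)) = arr_neg C (shift_arr C p)"
    using cmp_neg_right[OF idm_Hom[OF shift_obj[OF ob(4)]] sp] cmp_idm_right[OF sp]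
      shift_idm[OF ob(4)] by simp
  then have "arr_neg C (shift_arr C p) = arr_neg C (shift_arr C (f \<cdot> k))"
    using c(2) k(2) cmp_neg_left[OF sk sf] shift_cmp[OF k(1) H(1)] by simp
  then have "shift_arr C p = shift_arr C (f \<cdot> k)"
    by (metis arr_neg_neg assms(2) fk shift_Hom)
  then show ?thesis using that[OF k(1)] shift_inj[OF assms(2) fk] by simp
qed

text \<open>Here the comparison with the triangle 0 -> w -> w works without rotation.\<close>

lemma exact_right:
  assumes "tri x y z f g h" "p \<in> Hom C y w" "p \<cdot> f = arr_zero C x w"
  obtains k where "k \<in> Hom C z w" "k \<cdot> g = p"
proof -
  obtain o' where z: "zero_obj C o'" using ex_zero_obj by blast
  note ob = tri_obj[OF assms(1)] Hom_obj(2)[OF assms(2)] zero_obj_obj[OF z]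
  have eq: "p \<cdot> f = arr_zero C o' w \<cdot> arr_zero C x o'"
    using assms(3) cmp_zero_left[OF arr_zero_Hom] ob by simp
  obtain c where "c \<in> Hom C z w" "c \<cdot> g = idm C w \<cdot> p"
    using tri_map[OF assms(1) tri_idm_right[OF ob(4) z] arr_zero_Hom[OF ob(1,5)] assms(2) eq]
    by metis
  then show ?thesis using that cmp_idm_left assms(2) by metis
qed

text \<open>The triangle x -> x -> 0 maps to the given one by the identity and \<open>f\<close>; the
  third component starts at a zero object, so \<open>g \<cdot> f\<close> factors through
  zero.\<close>

lemma tri_cmp_zero:
  assumes "tri x y z f g h"
  shows "g \<cdot> f = arr_zero C x z"
proof -
  obtain o' where z: "zero_obj C o'" using ex_zero_obj by blast
  note ob = tri_obj[OF assms] zero_obj_obj[OF z]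
  have H: "f \<in> Hom C x y" "g \<in> Hom C y z" using assms unfolding tri_def by auto
  have "f \<cdot> idm C x = f \<cdot> idm C x" ..
  then obtain c where c: "c \<in> Hom C o' z" "c \<cdot> arr_zero C x o' = g \<cdot> f"
    using tri_map[OF tri_idm[OF ob(1) z] assms idm_Hom[OF ob(1)] H(1)] by metis
  then show ?thesis using cmp_zero_right ob by metis
qed

lemma tri_cmp_zero':
  assumes "tri x y z f g h"
  shows "h \<cdot> g = arr_zero C y (shift_obj C x)"
    "shift_arr C f \<cdot> h = arr_zero C z (shift_obj C y)"
proof -
  show "h \<cdot> g = arr_zero C y (shift_obj C x)" using tri_cmp_zero[OF tri_rotate[OF assms]] .
  have H: "h \<in> Hom C z (shift_obj C x)" "shift_arr C f \<in> Hom C (shift_obj C x) (shift_obj C y)"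
    using assms shift_Hom unfolding tri_def by auto
  have "arr_neg C (shift_arr C f \<cdot> h) = arr_zero C z (shift_obj C y)"
    using tri_cmp_zero[OF tri_rotate[OF tri_rotate[OF assms]]] cmp_neg_left[OF H] by simp
  then show "shift_arr C f \<cdot> h = arr_zero C z (shift_obj C y)"
    using neg_eq_zero cmp_Hom[OF H] by blast
qed

lemma orth_ext_right:
  assumes "tri x y z f g h" "orth w x" "orth w z"
  shows "orth w y"
  unfolding orth_def
proof (intro conjI ballI)
  show w: "w \<in> obj C" "y \<in> obj C" using assms tri_obj unfolding orth_def by blast+
  have H: "f \<in> Hom C x y" "g \<in> Hom C y z" using assms(1) unfolding tri_def by auto
  fix p assume p: "p \<in> Hom C w y"
  then have "g \<cdot> p = arr_zero C w z" using cmp_Hom H assms(3) unfolding orth_def by blast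
  then obtain k where "k \<in> Hom C w x" "f \<cdot> k = p" using exact_left[OF assms(1) p] by blast
  then show "p = arr_zero C w y" using assms(2) cmp_zero_right[OF H(1)] w unfolding orth_def by metis
qed

lemma orth_ext_left:
  assumes "tri x y z f g h" "orth x w" "orth z w"
  shows "orth y w"
  unfolding orth_def
proof (intro conjI ballI)
  show w: "y \<in> obj C" "w \<in> obj C" using assms tri_obj unfolding orth_def by blast+
  have H: "f \<in> Hom C x y" "g \<in> Hom C y z" using assms(1) unfolding tri_def by auto
  fix p assume p: "p \<in> Hom C y w"
  then have "p \<cdot> f = arr_zero C x w" using cmp_Hom H assms(2) unfolding orth_def by blast
  then obtain k where "k \<in> Hom C z w" "k \<cdot> g = p" using exact_right[OF assms(1) p] by blast
  then show "p = arr_zero C y w" using assms(3) cmp_zero_left[OF H(2)] w unfolding orth_def by metis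
qed

text \<open>By exactness of the rotated triangle, the shift of a map killed by \<open>f\<close>
  factors through a map from w[1] to z, and such maps vanish. This is the uniqueness that
  accompanies \<open>exact_left\<close>.\<close>

lemma tri_left_cancel_zero:
  assumes "tri x y z f g h" "orth (shift_obj C w) z" "j \<in> Hom C w x" "f \<cdot> j = arr_zero C w y"
  shows "j = arr_zero C w x"
proof -
  have H: "f \<in> Hom C x y" "h \<in> Hom C z (shift_obj C x)" using assms(1) unfolding tri_def by auto
  note ob = tri_obj[OF assms(1)] Hom_obj(1)[OF assms(3)]
  have "arr_neg C (shift_arr C f) \<cdot> shift_arr C j = arr_zero C (shift_obj C w) (shift_obj C y)"
    using cmp_neg_left[OF shift_Hom[OF assms(3)] shift_Hom[OF H(1)]] shift_cmp[OF assms(3) H(1)]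
      assms(4) shift_zero arr_neg_zero ob shift_obj by metis
  then obtain m where "m \<in> Hom C (shift_obj C w) z" "h \<cdot> m = shift_arr C j"
    using exact_left[OF tri_rotate[OF tri_rotate[OF assms(1)]] shift_Hom[OF assms(3)]] by blast
  then have "shift_arr C j = shift_arr C (arr_zero C w x)"
    using assms(2) cmp_zero_right[OF H(2)] ob shift_obj shift_zero unfolding orth_def by metis
  then show ?thesis using shift_inj[OF assms(3)] arr_zero_Hom ob by blast
qed

text \<open>The dual argument, giving the uniqueness that accompanies
  \<open>exact_right\<close>.\<close>

lemma tri_right_cancel_zero:
  assumes "tri x y z f g h" "orth (shift_obj C x) w" "j \<in> Hom C z w" "j \<cdot> g = arr_zero C y w"
  shows "j = arr_zero C z w"
proof -
  have H: "h \<in> Hom C z (shift_obj C x)" using assms(1) unfolding tri_def by auto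
  obtain m where "m \<in> Hom C (shift_obj C x) w" "m \<cdot> h = j"
    using exact_right[OF tri_rotate[OF assms(1)] assms(3,4)] by blast
  then show ?thesis
    using assms(2) cmp_zero_left[OF H] Hom_obj assms(3) unfolding orth_def by metis
qed

lemma tri_left_cancel:
  assumes "tri x y z f g h" "orth (shift_obj C w) z" "j \<in> Hom C w x" "k \<in> Hom C w x"
    "f \<cdot> j = f \<cdot> k"
  shows "j = k"
proof (rule arr_eqI[OF assms(3,4)], rule tri_left_cancel_zero[OF assms(1,2)])
  have H: "f \<in> Hom C x y" using assms(1) unfolding tri_def by auto
  show "arr_add C j (arr_neg C k) \<in> Hom C w x" using arr_add_Hom arr_neg_Hom assms by blast
  show "f \<cdot> arr_add C j (arr_neg C k) = arr_zero C w y"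
    using cmp_add_right[OF assms(3) arr_neg_Hom[OF assms(4)] H] cmp_neg_right[OF assms(4) H]
      arr_add_neg[OF cmp_Hom[OF assms(4) H]] assms(5) by simp
qed

lemma tri_right_cancel:
  assumes "tri x y z f g h" "orth (shift_obj C x) w" "j \<in> Hom C z w" "k \<in> Hom C z w"
    "j \<cdot> g = k \<cdot> g"
  shows "j = k"
proof (rule arr_eqI[OF assms(3,4)], rule tri_right_cancel_zero[OF assms(1,2)])
  have H: "g \<in> Hom C y z" using assms(1) unfolding tri_def by auto
  show "arr_add C j (arr_neg C k) \<in> Hom C z w" using arr_add_Hom arr_neg_Hom assms by blast
  show "arr_add C j (arr_neg C k) \<cdot> g = arr_zero C y w"
    using cmp_add_left[OF H assms(3) arr_neg_Hom[OF assms(4)]] cmp_neg_left[OF H assms(4)]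
      arr_add_neg[OF cmp_Hom[OF H assms(4)]] assms(5) by simp
qed

section \<open>Isomorphisms in triangles, shifted triangles, cocones and the octahedron\<close>

lemma tri_zero_left_iso:
  assumes "tri x y z f g h" "zero_obj C x"
  shows "is_iso C g"
proof -
  have H: "f \<in> Hom C x y" "g \<in> Hom C y z" using assms(1) unfolding tri_def by auto
  note ob = tri_obj[OF assms(1)]
  \<comment> \<open>Restricted to the zero object \<open>x\<close> the identity of \<open>y\<close>
    vanishes, so it factors through \<open>g\<close>; the factor is a left inverse, and cancelling
    \<open>g\<close> makes it two-sided.\<close>
  have "idm C y \<cdot> f = arr_zero C x y"
    using orth_zero_left[OF assms(2) ob(2)] cmp_Hom[OF H(1) idm_Hom[OF ob(2)]]
    unfolding orth_def by blast
  then obtain k where k: "k \<in> Hom C z y" "k \<cdot> g = idm C y"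
    using exact_right[OF assms(1) idm_Hom[OF ob(2)]] by blast
  have "(g \<cdot> k) \<cdot> g = idm C z \<cdot> g"
    using cmp_assoc[OF H(2) k(1) H(2)] k(2) cmp_idm_left[OF H(2)] cmp_idm_right[OF H(2)] by simp
  then have "g \<cdot> k = idm C z"
    using tri_right_cancel[OF assms(1) orth_zero_left[OF shift_zero_obj[OF assms(2)]]
        cmp_Hom[OF k(1) H(2)] idm_Hom] ob by blast
  then show ?thesis using is_isoI H k by blast
qed

text \<open>Transport of the identity triangle on \<open>x\<close> along the identity of
  \<open>x\<close>, \<open>f\<close> and the identity of \<open>z\<close>.\<close>

lemma tri_iso:
  assumes "is_iso C f" "f \<in> Hom C x y" "zero_obj C z"
  shows "tri x y z f (arr_zero C y z) (arr_zero C z (shift_obj C x))"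
proof -
  note ob = Hom_obj[OF assms(2)] zero_obj_obj[OF assms(3)]
  have "(f, arr_zero C y z, arr_zero C z (shift_obj C x)) \<in> triangles C"
  proof (rule triangle_iso_closed[OF triangle_idm[OF ob(1) assms(3)], where a = "idm C x" and b = f
        and c = "idm C z" and x' = x and y' = y and z' = z])
    show "f \<cdot> idm C x = f \<cdot> idm C x" ..
    show "idm C z \<cdot> arr_zero C x z = arr_zero C y z \<cdot> f"
      using cmp_idm_left[OF arr_zero_Hom[OF ob(1,3)]] cmp_zero_left[OF assms(2) ob(3)] by simp
    show "shift_arr C (idm C x) \<cdot> arr_zero C z (shift_obj C x) =
        arr_zero C z (shift_obj C x) \<cdot> idm C z"
      using ob shift_idm shift_obj
      by (simp add: cmp_idm_left[OF arr_zero_Hom] cmp_idm_right[OF arr_zero_Hom])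
    show "idm C x \<in> Hom C (src C (idm C x)) x" "f \<in> Hom C (tgt C (idm C x)) y"
      "idm C z \<in> Hom C (tgt C (arr_zero C x z)) z"
      using idm_Hom[OF ob(1)] assms(2) idm_Hom[OF ob(3)] arr_zero_Hom[OF ob(1,3)]
      by (simp_all add: Hom_def)
  qed (use assms ob arr_zero_Hom shift_obj is_iso_idm in auto)
  then show ?thesis using triI assms(2) arr_zero_Hom ob by blast
qed

text \<open>Three rotations, each of which puts a sign on one map.\<close>

lemma tri_shift:
  assumes "tri x y z f g h"
  shows "tri (shift_obj C x) (shift_obj C y) (shift_obj C z)
    (arr_neg C (shift_arr C f)) (arr_neg C (shift_arr C g)) (arr_neg C (shift_arr C h))"
  using assms tri_rotate by blast

text \<open>Fullness of the shift unshifts the three maps, signs included; then the three rotations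
  are undone one at a time.\<close>

lemma tri_unshift:
  assumes "tri (shift_obj C x) (shift_obj C y) (shift_obj C z) f g h"
    and "x \<in> obj C" "y \<in> obj C" "z \<in> obj C"
  obtains f' g' h' where "tri x y z f' g' h'" "f = arr_neg C (shift_arr C f')"
    "g = arr_neg C (shift_arr C g')"
proof -
  have lift: "\<exists>f'. f' \<in> Hom C a b \<and> f = arr_neg C (shift_arr C f')"
    if "f \<in> Hom C (shift_obj C a) (shift_obj C b)" "a \<in> obj C" "b \<in> obj C" for f a b
    using shift_full[OF arr_neg_Hom[OF that(1)] that(2,3)] arr_neg_neg[OF that(1)] by metis
  obtain f' g' h' where
    l: "f' \<in> Hom C x y" "f = arr_neg C (shift_arr C f')"
    "g' \<in> Hom C y z" "g = arr_neg C (shift_arr C g')"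
    "h' \<in> Hom C z (shift_obj C x)" "h = arr_neg C (shift_arr C h')"
    using lift assms shift_obj unfolding tri_def by metis
  have "tri z (shift_obj C x) (shift_obj C y) h' f g"
    using tri_rotate_back[OF l(5)] assms(1) l(6) by simp
  then have "tri y z (shift_obj C x) g' h' f" using tri_rotate_back[OF l(3)] l(4) by simp
  then have "tri x y z f' g' h'" using tri_rotate_back[OF l(1)] l(2) by simp
  then show ?thesis using that l by blast
qed

text \<open>The shift is only essentially surjective, so the cone of \<open>g\<close> is merely
  isomorphic to some x[1]. The triangle is transported along that isomorphism before it is rotated
  back.\<close>

lemma ex_cocone:
  assumes "g \<in> Hom C y z"
  obtains x f h where "tri x y z f g h"
proof -
  obtain c h k where c: "tri y z c g h k" using ex_cone[OF assms] .
  obtain x a where x: "x \<in> obj C" "a \<in> Hom C (shift_obj C x) c" "is_iso C a"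
    using shift_ess_surj[OF tri_obj(3)[OF c]] unfolding isomorphic_def by blast
  obtain b where b: "b \<in> Hom C c (shift_obj C x)" "is_iso C b" "a \<cdot> b = idm C c"
    using is_isoE[OF x(3,2)] by metis
  have H: "h \<in> Hom C z c" "k \<in> Hom C c (shift_obj C y)" using c unfolding tri_def by auto
  note ob = tri_obj[OF c]
  have kH: "k \<cdot> a \<in> Hom C (shift_obj C x) (shift_obj C y)" using cmp_Hom[OF x(2) H(2)] .
  have "(g, b \<cdot> h, k \<cdot> a) \<in> triangles C"
  proof (rule triangle_iso_closed[where f = g and g = h and h = k and a = "idm C y"
        and b = "idm C z" and c = b and x' = y and y' = z and z' = "shift_obj C x"])
    show "(g, h, k) \<in> triangles C" using c unfolding tri_def by blast
    show "g \<in> Hom C y z" "b \<cdot> h \<in> Hom C z (shift_obj C x)"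
      "k \<cdot> a \<in> Hom C (shift_obj C x) (shift_obj C y)"
      using assms cmp_Hom[OF H(1) b(1)] kH by auto
    show "idm C y \<in> Hom C (src C g) y" "idm C z \<in> Hom C (tgt C g) z"
      "b \<in> Hom C (tgt C h) (shift_obj C x)"
      using idm_Hom ob Hom_src[OF assms] Hom_tgt[OF assms] Hom_tgt[OF H(1)] b by auto
    show "is_iso C (idm C y)" "is_iso C (idm C z)" "is_iso C b" using is_iso_idm ob b by auto
    show "idm C z \<cdot> g = g \<cdot> idm C y" using cmp_idm_left[OF assms] cmp_idm_right[OF assms] by simp
    show "b \<cdot> h = (b \<cdot> h) \<cdot> idm C z" using cmp_idm_right[OF cmp_Hom[OF H(1) b(1)]] by simp
    have "(k \<cdot> a) \<cdot> b = k" using cmp_assoc[OF b(1) x(2) H(2)] b(3) cmp_idm_right[OF H(2)] by simp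
    then show "shift_arr C (idm C y) \<cdot> k = (k \<cdot> a) \<cdot> b"
      using shift_idm ob cmp_idm_left[OF H(2)] by simp
  qed
  then have t: "tri y z (shift_obj C x) g (b \<cdot> h) (k \<cdot> a)"
    unfolding tri_def using assms cmp_Hom[OF H(1) b(1)] kH by blast
  obtain f where f: "f \<in> Hom C x y" "arr_neg C (k \<cdot> a) = shift_arr C f"
    using shift_full[OF arr_neg_Hom[OF kH] x(1) ob(1)] .
  then have "k \<cdot> a = arr_neg C (shift_arr C f)" using arr_neg_neg[OF kH] by simp
  then show ?thesis using that tri_rotate_back[OF f(1)] t by metis
qed

lemma octahedron:
  assumes "tri x y u f f' f''" "tri y z w g g' g''" "tri x z v (g \<cdot> f) k' k''"
  obtains a b c where "tri u v w a b c" "a \<cdot> f' = k' \<cdot> g" "b \<cdot> k' = g'"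
proof -
  have t: "tgt C f' = u" "tgt C k' = v" "tgt C g' = w"
    using assms unfolding tri_def Hom_def by auto
  obtain a b where ab: "a \<in> Hom C u v" "b \<in> Hom C v w"
    "(a, b, shift_arr C f' \<cdot> g'') \<in> triangles C" "a \<cdot> f' = k' \<cdot> g" "b \<cdot> k' = g'"
    using octahedral[of f x y g z f' f'' g' g'' k' k''] assms t unfolding tri_def by metis
  show ?thesis using that triI[OF ab(3,1,2)] ab by blast
qed

end

section \<open>Central charges and Harder--Narasimhan filtrations\<close>

lemma keys_diff_subset:
  "\<lbrakk>Poly_Mapping.keys a \<subseteq> S; Poly_Mapping.keys b \<subseteq> S\<rbrakk> \<Longrightarrow> Poly_Mapping.keys (a - b) \<subseteq> S"
  by (rule subset_trans[OF keys_diff]) simp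

section \<open>Homomorphisms on the Grothendieck group\<close>

context triangulated_category
begin

lemma K_relations_normal: "K_relations C \<lhd> free_Abelian_group (obj C)"
proof -
  interpret F: comm_group "free_Abelian_group (obj C)" by (rule abelian_free_Abelian_group)
  have "subgroup (K_relations C) (free_Abelian_group (obj C))"
    unfolding K_relations_def
  proof (rule F.generate_is_subgroup, clarify)
    fix f g h assume "(f, g, h) \<in> triangles C"
    then obtain x y z where "f \<in> Hom C x y" "g \<in> Hom C y z" using triangle_shape by blast
    then have "tgt C f \<in> obj C" "src C f \<in> obj C" "tgt C g \<in> obj C"
      using src_obj tgt_obj by (auto simp: Hom_def)
    then show "frag_of (tgt C f) - frag_of (src C f) - frag_of (tgt C g) \<in>
        carrier (free_Abelian_group (obj C))"
      by (simp add: keys_diff_subset)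
  qed
  then show ?thesis using F.subgroup_imp_normal by blast
qed

text \<open>Pulled back to formal sums of objects, a homomorphism on \<open>K_group C\<close> is
  additive and kills the relations; additivity on triangles follows from these two facts.\<close>

lemma K_hom_coset:
  fixes Z :: "('o \<Rightarrow>\<^sub>0 int) set \<Rightarrow> complex"
  assumes "Z \<in> hom (K_group C) complex_group"
  defines "F \<equiv> free_Abelian_group (obj C)"
  shows "\<lbrakk>a \<in> carrier F; b \<in> carrier F\<rbrakk> \<Longrightarrow>
      Z (K_relations C #>\<^bsub>F\<^esub> (a + b)) = Z (K_relations C #>\<^bsub>F\<^esub> a) + Z (K_relations C #>\<^bsub>F\<^esub> b)"
    and "a \<in> K_relations C \<Longrightarrow> Z (K_relations C #>\<^bsub>F\<^esub> a) = 0"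
proof -
  let ?R = "K_relations C"
  interpret F: comm_group F unfolding F_def by (rule abelian_free_Abelian_group)
  interpret R: normal ?R F unfolding F_def by (rule K_relations_normal)
  have K: "K_group C = F Mod ?R" by (simp add: K_group_def F_def)
  have cl: "?R #>\<^bsub>F\<^esub> a \<in> carrier (F Mod ?R)" if "a \<in> carrier F" for a
    using that by (auto simp: FactGroup_def RCOSETS_def)
  have add: "Z (?R #>\<^bsub>F\<^esub> (a + b)) = Z (?R #>\<^bsub>F\<^esub> a) + Z (?R #>\<^bsub>F\<^esub> b)"
    if "a \<in> carrier F" "b \<in> carrier F" for a b
  proof -
    have "?R #>\<^bsub>F\<^esub> (a + b) = (?R #>\<^bsub>F\<^esub> a) \<otimes>\<^bsub>F Mod ?R\<^esub> (?R #>\<^bsub>F\<^esub> b)"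
      using R.rcos_sum[OF that] by (simp add: FactGroup_def F_def)
    then show ?thesis using hom_mult[OF assms(1)] cl that K by (simp add: complex_group_def)
  qed
  then show "\<lbrakk>a \<in> carrier F; b \<in> carrier F\<rbrakk> \<Longrightarrow>
      Z (?R #>\<^bsub>F\<^esub> (a + b)) = Z (?R #>\<^bsub>F\<^esub> a) + Z (?R #>\<^bsub>F\<^esub> b)" .
  assume a: "a \<in> ?R"
  have o: "0 \<in> carrier F" unfolding F_def by simp
  have "Z (?R #>\<^bsub>F\<^esub> 0) = 0" using add[OF o o] by simp
  moreover have "?R #>\<^bsub>F\<^esub> a = ?R" "?R #>\<^bsub>F\<^esub> 0 = ?R"
    using F.coset_join2[OF _ R.subgroup_axioms] a R.subset R.one_closed o unfolding F_def by auto
  ultimately show "Z (?R #>\<^bsub>F\<^esub> a) = 0" by simp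
qed

lemma K_hom_triangle:
  assumes Z: "Z \<in> hom (K_group C) complex_group" and t: "tri x y z f g h"
  shows "Z (K_class C y) = Z (K_class C x) + Z (K_class C z)"
proof -
  let ?F = "free_Abelian_group (obj C)"
  let ?r = "frag_of y - frag_of x - frag_of z"
  note ob = tri_obj[OF t]
  have s: "src C f = x" "tgt C f = y" "tgt C g = z" "(f, g, h) \<in> triangles C"
    using t unfolding tri_def Hom_def by auto
  have "?r \<in> K_relations C"
    unfolding K_relations_def by (rule generate.incl) (use s in blast)
  moreover have c: "?r \<in> carrier ?F" "frag_of x + frag_of z \<in> carrier ?F"
    using ob by (auto simp: keys_diff_subset intro!: subset_trans[OF Poly_Mapping.keys_add])
  moreover have "frag_of y = ?r + (frag_of x + frag_of z)" by simp
  ultimately have "Z (K_class C y) = Z (K_relations C #>\<^bsub>?F\<^esub> (frag_of x + frag_of z))"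
    unfolding K_class_def using K_hom_coset[OF Z] by (metis add_0)
  then show ?thesis unfolding K_class_def using K_hom_coset(1)[OF Z] ob by simp
qed

lemma K_class_carrier: "x \<in> obj C \<Longrightarrow> K_class C x \<in> carrier (K_group C)"
  unfolding K_class_def K_group_def FactGroup_def RCOSETS_def by auto

text \<open>Classes of objects generate: induction on formal sums, where differences are handled by
  additivity for \<open>a - b\<close> and \<open>b\<close>.\<close>

lemma K_hom_eqI:
  assumes Z: "Z \<in> hom (K_group C) complex_group" and Z': "Z' \<in> hom (K_group C) complex_group"
    and eq: "\<And>x. x \<in> obj C \<Longrightarrow> Z (K_class C x) = Z' (K_class C x)"
    and k: "k \<in> carrier (K_group C)"
  shows "Z k = Z' k"
proof -
  let ?F = "free_Abelian_group (obj C)" and ?R = "K_relations C"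
  let ?P = "\<lambda>a. Poly_Mapping.keys a \<subseteq> obj C \<and> Z (?R #>\<^bsub>?F\<^esub> a) = Z' (?R #>\<^bsub>?F\<^esub> a)"
  obtain a where a: "Poly_Mapping.keys a \<subseteq> obj C" "k = ?R #>\<^bsub>?F\<^esub> a"
    using k unfolding K_group_def FactGroup_def RCOSETS_def by auto
  have "?P a"
    using a(1)
  proof (induction rule: frag_induction)
    case zero
    show ?case using K_hom_coset(1)[OF Z, of 0 0] K_hom_coset(1)[OF Z', of 0 0] by simp
  next
    case (one x)
    then show ?case using eq unfolding K_class_def by simp
  next
    case (diff a b)
    then have "Poly_Mapping.keys (a - b) \<subseteq> obj C" by (simp add: keys_diff_subset)
    then show ?case
      using diff K_hom_coset(1)[OF Z, of "a - b" b] K_hom_coset(1)[OF Z', of "a - b" b] by simp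
  qed
  then show ?thesis using a by simp
qed

end

section \<open>Charges and phases for one stability condition\<close>

locale stability = triangulated_category C
  for C :: "('o, 'm, 'e) triangulated_cat_scheme" (structure) +
  fixes P :: "real \<Rightarrow> 'o set" and Z :: "('o \<Rightarrow>\<^sub>0 int) set \<Rightarrow> complex"
  assumes in_Stab: "(P, Z) \<in> Stab C"
begin

abbreviation charge :: "'o \<Rightarrow> complex" where
  "charge x \<equiv> Z (K_class C x)"

lemma slicing: "slicing C P" and Z_hom: "Z \<in> hom (K_group C) complex_group"
  and locally_finite: "locally_finite C P"
  and Z_extensional: "Z \<in> extensional (carrier (K_group C))"
  using in_Stab unfolding Stab_def by auto

lemma charge_tri: "tri x y z f g h \<Longrightarrow> charge y = charge x + charge z"
  using K_hom_triangle Z_hom by blast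

lemma charge_zero: "zero_obj C z \<Longrightarrow> charge z = 0"
  using charge_tri[OF tri_idm[OF zero_obj_obj]] by auto

text \<open>An isomorphism fits in a triangle whose third vertex is zero.\<close>

lemma charge_isomorphic:
  assumes "isomorphic C x y" shows "charge x = charge y"
proof -
  obtain z where z: "zero_obj C z" using ex_zero_obj by blast
  obtain f where "f \<in> Hom C x y" "is_iso C f" using assms unfolding isomorphic_def by blast
  then show ?thesis using charge_tri[OF tri_iso[OF _ _ z]] charge_zero[OF z] by simp
qed

lemma P_obj: "x \<in> P \<phi> \<Longrightarrow> x \<in> obj C"
  using slicing unfolding slicing_def by blast

lemma P_isomorphic: "\<lbrakk>x \<in> P \<phi>; isomorphic C x y\<rbrakk> \<Longrightarrow> y \<in> P \<phi>"
proof -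
  assume "x \<in> P \<phi>" "isomorphic C x y"
  moreover then have "y \<in> obj C" unfolding isomorphic_def using Hom_obj by blast
  ultimately show ?thesis using slicing unfolding slicing_def iso_closure_def by blast
qed

lemma P_zero: "zero_obj C z \<Longrightarrow> z \<in> P \<phi>"
  using slicing unfolding slicing_def by blast

lemma P_shift: "P (\<phi> + 1) = iso_closure C (shift_obj C ` P \<phi>)"
  using slicing unfolding slicing_def by blast

lemma P_shift_obj: "x \<in> P \<phi> \<Longrightarrow> shift_obj C x \<in> P (\<phi> + 1)"
  using isomorphic_refl[OF shift_obj[OF P_obj]] shift_obj[OF P_obj]
  unfolding P_shift iso_closure_def by blast

lemma P_orth: "\<lbrakk>x \<in> P \<phi>; y \<in> P \<psi>; \<phi> > \<psi>\<rbrakk> \<Longrightarrow> orth x y"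
  using slicing P_obj unfolding slicing_def orth_def by blast

lemma charge_phase:
  assumes "x \<in> P \<phi>" "\<not> zero_obj C x"
  obtains r where "r > 0" "charge x = of_real r * exp (\<i> * pi * \<phi>)"
  using in_Stab assms unfolding Stab_def by blast

lemma charge_phase':
  assumes "x \<in> P \<phi>"
  shows "charge x = of_real (cmod (charge x)) * exp (\<i> * pi * \<phi>)"
proof (cases "zero_obj C x")
  case False
  then obtain r where "r > 0" "charge x = of_real r * exp (\<i> * pi * \<phi>)"
    using charge_phase assms by blast
  then show ?thesis by (simp add: norm_mult)
qed (simp add: charge_zero)

lemma charge_nonzero: "\<lbrakk>x \<in> P \<phi>; \<not> zero_obj C x\<rbrakk> \<Longrightarrow> charge x \<noteq> 0"
  by (rule charge_phase) auto

section \<open>Extension-closed slices\<close>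

lemma slice_base: "\<lbrakk>x \<in> P \<phi>; \<phi> \<in> I\<rbrakk> \<Longrightarrow> x \<in> slice C P I"
  using slice.base[of \<phi> I x P C] .

lemma slice_ext: "\<lbrakk>tri x y z f g h; x \<in> slice C P I; z \<in> slice C P I\<rbrakk> \<Longrightarrow> y \<in> slice C P I"
  using slice.ext[of f g h C x y z P I] unfolding tri_def by blast

lemma slice_obj: "x \<in> slice C P I \<Longrightarrow> x \<in> obj C"
  by (induction rule: slice.induct) (use P_obj Hom_obj in auto)

lemma slice_mono: "\<lbrakk>x \<in> slice C P I; I \<subseteq> J\<rbrakk> \<Longrightarrow> x \<in> slice C P J"
proof (induction rule: slice.induct)
  case (base \<phi> x)
  then show ?case using slice_base by blast
next
  case (ext f g h x y z)
  then show ?case using slice_ext[OF triI] by blast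
qed

lemma slice_zero: "\<lbrakk>zero_obj C z; I \<noteq> {}\<rbrakk> \<Longrightarrow> z \<in> slice C P I"
  using P_zero slice_base by blast

lemma slice_shift: "x \<in> slice C P I \<Longrightarrow> shift_obj C x \<in> slice C P ((\<lambda>t. t + 1) ` I)"
proof (induction rule: slice.induct)
  case (base \<phi> x)
  show ?case
    by (rule slice_base[OF P_shift_obj[OF base(2)]]) (use base(1) in simp)
next
  case (ext f g h x y z)
  then show ?case using slice_ext[OF tri_shift[OF triI]] by blast
qed

text \<open>Vanishing of Hom passes through extensions in either variable, so it is enough to know
  it on the generators of both slices.\<close>

lemma slice_orth:
  assumes "x \<in> slice C P I" "y \<in> slice C P J" "\<And>s t. \<lbrakk>s \<in> I; t \<in> J\<rbrakk> \<Longrightarrow> s > t"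
  shows "orth x y"
  using assms(1)
proof (induction rule: slice.induct)
  case (base \<phi> x)
  show ?case
    using assms(2)
  proof (induction rule: slice.induct)
    case (base \<psi> y)
    then show ?case using P_orth assms(3) \<open>\<phi> \<in> I\<close> \<open>x \<in> P \<phi>\<close> by blast
  next
    case (ext f g h u v w)
    then show ?case using orth_ext_right[OF triI] by blast
  qed
next
  case (ext f g h u v w)
  then show ?case using orth_ext_left[OF triI] by blast
qed

section \<open>Harder--Narasimhan filtrations\<close>

lemma HN_prefix: "\<lbrakk>HN_filtration C P x n E A \<phi>; k \<le> n\<rbrakk> \<Longrightarrow> HN_filtration C P (E k) k E A \<phi>"
  unfolding HN_filtration_def by auto

lemma HN_step:
  assumes "HN_filtration C P x n E A \<phi>" "i < n"
  obtains f g h where "tri (E i) (E (Suc i)) (A i) f g h"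
proof -
  obtain f g h where "(f, g, h) \<in> triangles C" "f \<in> Hom C (E i) (E (Suc i))"
    "g \<in> Hom C (E (Suc i)) (A i)"
    using assms unfolding HN_filtration_def by blast
  then show ?thesis using that[OF triI] by blast
qed

lemma HN_factor:
  assumes "HN_filtration C P x n E A \<phi>" "i < n"
  shows "A i \<in> P (\<phi> i)" "\<not> zero_obj C (A i)"
  using assms unfolding HN_filtration_def by blast+

lemma HN_obj:
  assumes "HN_filtration C P x n E A \<phi>" shows "x \<in> obj C"
proof (cases n)
  case 0
  then show ?thesis using assms zero_obj_obj unfolding HN_filtration_def by auto
next
  case (Suc k)
  then have "k < n" "x = E (Suc k)" using assms unfolding HN_filtration_def by auto
  then show ?thesis using HN_step[OF assms] tri_obj(2) by metis
qed

text \<open>The slicing axiom covers non-zero objects; a zero object has the filtration of length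
  0.\<close>

lemma HN_exists:
  assumes "x \<in> obj C"
  obtains n E A \<phi> where "HN_filtration C P x n E A \<phi>"
proof (cases "zero_obj C x")
  case True
  then have "HN_filtration C P x 0 (\<lambda>_. x) A \<phi>" for A \<phi> unfolding HN_filtration_def by auto
  then show ?thesis using that by blast
next
  case False
  then show ?thesis using assms slicing that unfolding slicing_def by meson
qed

lemma HN_charge:
  "HN_filtration C P x n E A \<phi> \<Longrightarrow> charge x = (\<Sum>i<n. charge (A i))"
proof (induction n arbitrary: x)
  case 0
  then show ?case using charge_zero unfolding HN_filtration_def by auto
next
  case (Suc n)
  have "charge (E n) = (\<Sum>i<n. charge (A i))" using Suc HN_prefix by fastforce
  moreover have "x = E (Suc n)" using Suc(2) unfolding HN_filtration_def by blast
  moreover obtain f g h where "tri (E n) (E (Suc n)) (A n) f g h" using HN_step[OF Suc(2) lessI] .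
  ultimately show ?case using charge_tri by simp
qed

lemma HN_slice:
  assumes "HN_filtration C P x n E A \<phi>" "\<And>i. i < n \<Longrightarrow> \<phi> i \<in> I" "I \<noteq> {}"
  shows "x \<in> slice C P I"
  using assms(1,2)
proof (induction n arbitrary: x)
  case 0
  then show ?case using slice_zero[OF _ assms(3)] unfolding HN_filtration_def by auto
next
  case (Suc n)
  have "E n \<in> slice C P I" using Suc HN_prefix by fastforce
  moreover have "x = E (Suc n)" using Suc(2) unfolding HN_filtration_def by blast
  moreover have "A n \<in> slice C P I" using slice_base[OF HN_factor(1)[OF Suc(2)]] Suc(3) by blast
  moreover obtain f g h where "tri (E n) (E (Suc n)) (A n) f g h" using HN_step[OF Suc(2) lessI] .
  ultimately show ?case using slice_ext by blast
qed

text \<open>The quotient of \<open>x\<close> by the step \<open>E k\<close> is assembled from the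
  remaining factors by repeated use of the octahedral axiom.\<close>

lemma HN_quotient:
  assumes "HN_filtration C P x n E A \<phi>" "k \<le> n" "\<And>i. \<lbrakk>k \<le> i; i < n\<rbrakk> \<Longrightarrow> \<phi> i \<in> J" "J \<noteq> {}"
  shows "\<exists>r \<in> slice C P J. \<exists>f g h. tri (E k) x r f g h"
  using assms(1,2,3)
proof (induction n arbitrary: x)
  case 0
  obtain z where z: "zero_obj C z" using ex_zero_obj by blast
  moreover have "E k = x" using 0 unfolding HN_filtration_def by simp
  ultimately show ?case using tri_idm[OF HN_obj[OF 0(1)] z] slice_zero[OF z assms(4)] by metis
next
  case (Suc n)
  have x: "x = E (Suc n)" using Suc(2) unfolding HN_filtration_def by blast
  show ?case
  proof (cases "k = Suc n")
    case True
    obtain z where z: "zero_obj C z" using ex_zero_obj by blast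
    show ?thesis using tri_idm[OF HN_obj[OF Suc(2)] z] slice_zero[OF z assms(4)] x True by metis
  next
    case False
    then obtain r f g h where r: "r \<in> slice C P J" "tri (E k) (E n) r f g h"
      using Suc.IH[OF HN_prefix[OF Suc(2)]] Suc(3,4) by fastforce
    obtain f' g' h' where t: "tri (E n) x (A n) f' g' h'" using HN_step[OF Suc(2) lessI] x by blast
    \<comment> \<open>The cone \<open>v\<close> of the composite E k -> E n -> x is, by the
      octahedron, an extension of \<open>A n\<close> by the quotient \<open>r\<close> already
      built.\<close>
    have "f' \<cdot> f \<in> Hom C (E k) x" using r t cmp_Hom unfolding tri_def by blast
    then obtain v k1 k2 where v: "tri (E k) x v (f' \<cdot> f) k1 k2" using ex_cone by blast
    obtain a b c where "tri r v (A n) a b c" using octahedron[OF r(2) t v] .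
    moreover have "A n \<in> slice C P J"
      using slice_base[OF HN_factor(1)[OF Suc(2)]] Suc(3,4) False by simp
    ultimately show ?thesis using v r slice_ext by blast
  qed
qed

end

section \<open>Truncation and uniqueness of Harder--Narasimhan factors\<close>

definition upper :: "real set \<Rightarrow> bool" where
  "upper I \<longleftrightarrow> I \<noteq> {} \<and> I \<noteq> UNIV \<and> (\<forall>s \<in> I. \<forall>t > s. t \<in> I)"

lemma upper_greater: "\<lbrakk>upper I; s \<in> I; t \<notin> I\<rbrakk> \<Longrightarrow> t < s"
  unfolding upper_def by (metis linorder_neqE_linordered_idom)

lemma upper_atLeast: "upper {t..}" and upper_greaterThan: "upper {t<..}"
proof -
  have "t - 1 \<notin> {t..}" "t \<in> {t..}" "t - 1 \<notin> {t<..}" "t + 1 \<in> {t<..}" by auto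
  then have "{t..} \<noteq> {}" "{t..} \<noteq> UNIV" "{t<..} \<noteq> {}" "{t<..} \<noteq> UNIV" by blast+
  then show "upper {t..}" "upper {t<..}" unfolding upper_def by auto
qed

lemma upper_shift: "upper I \<Longrightarrow> (\<lambda>t. t + 1) ` I \<subseteq> I"
  unfolding upper_def by auto

lemma Compl_upper_nonempty: "upper I \<Longrightarrow> - I \<noteq> {}"
  unfolding upper_def by blast

context stability
begin

definition truncation :: "real set \<Rightarrow> 'o \<Rightarrow> 'o \<Rightarrow> bool" where
  "truncation I y u \<longleftrightarrow> u \<in> slice C P I \<and> (\<exists>v \<in> slice C P (- I). \<exists>f g h. tri u y v f g h)"

text \<open>A truncation is unique up to isomorphism, which makes this description definite for
  \<open>upper I\<close>; see \<open>trunc_charge_eq\<close>.\<close>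

definition trunc_charge :: "real set \<Rightarrow> 'o \<Rightarrow> complex" where
  "trunc_charge I y = (THE c. \<exists>u. truncation I y u \<and> c = charge u)"

lemma slice_Compl_orth:
  "\<lbrakk>upper I; x \<in> slice C P I; y \<in> slice C P (- I)\<rbrakk> \<Longrightarrow> orth x y"
  using slice_orth upper_greater by (metis ComplD)

lemma slice_upper_shift: "\<lbrakk>upper I; x \<in> slice C P I\<rbrakk> \<Longrightarrow> shift_obj C x \<in> slice C P I"
  using slice_mono[OF slice_shift upper_shift] .

text \<open>The universal property of truncation: the composite from \<open>w\<close> to
  \<open>v\<close> vanishes for reasons of phase.\<close>

lemma truncation_lift:
  assumes I: "upper I" and t: "tri u y v f g h" "v \<in> slice C P (- I)"
    and p: "p \<in> Hom C w y" "w \<in> slice C P I"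
  obtains k where "k \<in> Hom C w u" "f \<cdot> k = p"
proof -
  have H: "g \<in> Hom C y v" using t unfolding tri_def by auto
  have "g \<cdot> p = arr_zero C w v"
    using slice_Compl_orth[OF I p(2) t(2)] cmp_Hom[OF p(1) H] unfolding orth_def by blast
  then show ?thesis using exact_left[OF t(1) p(1)] that by blast
qed

lemma truncation_cancel:
  assumes I: "upper I" and t: "tri u y v f g h" "v \<in> slice C P (- I)" "u \<in> slice C P I"
    and k: "k \<in> Hom C u u" "f \<cdot> k = f"
  shows "k = idm C u"
proof (rule tri_left_cancel[OF t(1) _ k(1)])
  show "orth (shift_obj C u) v" using slice_Compl_orth[OF I slice_upper_shift[OF I t(3)] t(2)] .
  show "idm C u \<in> Hom C u u" using idm_Hom tri_obj(1)[OF t(1)] .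
  show "f \<cdot> k = f \<cdot> idm C u" using k(2) t(1) cmp_idm_right[of f u y] unfolding tri_def by simp
qed

lemma truncation_isomorphic:
  assumes I: "upper I" and u: "truncation I y u" and u': "truncation I y u'"
  shows "isomorphic C u u'"
proof -
  obtain v f g h where v: "v \<in> slice C P (- I)" "tri u y v f g h" "u \<in> slice C P I"
    using u unfolding truncation_def by blast
  obtain v' f' g' h' where v': "v' \<in> slice C P (- I)" "tri u' y v' f' g' h'" "u' \<in> slice C P I"
    using u' unfolding truncation_def by blast
  have H: "f \<in> Hom C u y" "f' \<in> Hom C u' y" using v v' unfolding tri_def by auto
  obtain k where k: "k \<in> Hom C u u'" "f' \<cdot> k = f" using truncation_lift[OF I v'(2,1) H(1) v(3)] .
  obtain l where l: "l \<in> Hom C u' u" "f \<cdot> l = f'" using truncation_lift[OF I v(2,1) H(2) v'(3)] .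
  have "f \<cdot> (l \<cdot> k) = f" "f' \<cdot> (k \<cdot> l) = f'"
    using cmp_assoc[OF k(1) l(1) H(1)] cmp_assoc[OF l(1) k(1) H(2)] k(2) l(2) by auto
  then have "l \<cdot> k = idm C u" "k \<cdot> l = idm C u'"
    using truncation_cancel[OF I v(2,1,3) cmp_Hom[OF k(1) l(1)]]
      truncation_cancel[OF I v'(2,1,3) cmp_Hom[OF l(1) k(1)]] by auto
  then have "is_iso C k" using is_isoI k(1) l(1) by blast
  then show ?thesis unfolding isomorphic_def using k(1) by blast
qed

lemma trunc_charge_eq:
  assumes "upper I" "truncation I y u"
  shows "trunc_charge I y = charge u"
  unfolding trunc_charge_def
proof (rule the_equality)
  show "\<exists>w. truncation I y w \<and> charge u = charge w" using assms(2) by blast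
  show "c = charge u" if "\<exists>w. truncation I y w \<and> c = charge w" for c
    using that truncation_isomorphic[OF assms(1) _ assms(2)] charge_isomorphic by blast
qed

lemma truncationI:
  "\<lbrakk>tri u y v f g h; u \<in> slice C P I; v \<in> slice C P (- I)\<rbrakk> \<Longrightarrow> truncation I y u"
  unfolding truncation_def by blast

text \<open>Phases decrease along the filtration, so those in \<open>I\<close> form an initial
  segment, and the filtration step at its end is the truncation.\<close>

lemma HN_truncation:
  assumes "upper I" "HN_filtration C P y n E A \<phi>"
  shows "\<exists>k \<le> n. truncation I y (E k) \<and> {i. i < n \<and> \<phi> i \<in> I} = {..<k}"
proof -
  \<comment> \<open>The first index whose phase leaves \<open>I\<close>, or \<open>n\<close> if
    there is none.\<close>
  define k where "k = (LEAST k. k = n \<or> \<phi> k \<notin> I)"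
  have k: "k = n \<or> \<phi> k \<notin> I" unfolding k_def by (rule LeastI[of _ n]) simp
  have lt: "\<phi> i \<in> I" if "i < k" for i using not_less_Least[OF that[unfolded k_def]] by blast
  have kn: "k \<le> n" unfolding k_def by (rule Least_le) simp
  have dec: "\<phi> j < \<phi> i" if "i < j" "j < n" for i j
    using assms(2) that unfolding HN_filtration_def by blast
  have ge: "\<phi> i \<in> - I" if "k \<le> i" "i < n" for i
  proof (cases "i = k")
    case False
    then show ?thesis
      using k that dec[of k i] assms(1) unfolding upper_def by fastforce
  qed (use k that in auto)
  have "E k \<in> slice C P I"
    using HN_slice[OF HN_prefix[OF assms(2) kn]] lt assms(1) unfolding upper_def by blast
  moreover obtain r f g h where "r \<in> slice C P (- I)" "tri (E k) y r f g h"
    using HN_quotient[OF assms(2) kn ge Compl_upper_nonempty[OF assms(1)]] by blast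
  ultimately have "truncation I y (E k)" using truncationI by blast
  moreover have "{i. i < n \<and> \<phi> i \<in> I} = {..<k}"
    using lt ge kn by (auto simp: not_le[symmetric])
  ultimately show ?thesis using kn by blast
qed

lemma HN_trunc_charge:
  assumes "upper I" "HN_filtration C P y n E A \<phi>"
  shows "trunc_charge I y = (\<Sum>i | i < n \<and> \<phi> i \<in> I. charge (A i))"
proof -
  obtain k where k: "k \<le> n" "truncation I y (E k)" "{i. i < n \<and> \<phi> i \<in> I} = {..<k}"
    using HN_truncation[OF assms] by blast
  show ?thesis
    using trunc_charge_eq[OF assms(1) k(2)] HN_charge[OF HN_prefix[OF assms(2) k(1)]] k(3) by simp
qed

lemma truncation_exists:
  assumes "upper I" "y \<in> obj C"
  obtains u v f g h where "tri u y v f g h" "u \<in> slice C P I" "v \<in> slice C P (- I)"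
  using HN_truncation[OF assms(1)] HN_exists[OF assms(2)] unfolding truncation_def by metis

lemma trunc_charge_slice:
  assumes "upper I" "y \<in> slice C P I"
  shows "trunc_charge I y = charge y"
proof -
  obtain z where z: "zero_obj C z" using ex_zero_obj by blast
  show ?thesis
    using trunc_charge_eq[OF assms(1) truncationI[OF tri_idm[OF slice_obj[OF assms(2)] z] assms(2)
          slice_zero[OF z Compl_upper_nonempty[OF assms(1)]]]] .
qed

lemma trunc_charge_Compl:
  assumes "upper I" "y \<in> slice C P (- I)"
  shows "trunc_charge I y = 0"
proof -
  obtain z where z: "zero_obj C z" using ex_zero_obj by blast
  have "I \<noteq> {}" using assms(1) unfolding upper_def by blast
  then show ?thesis
    using trunc_charge_eq[OF assms(1) truncationI[OF tri_idm_right[OF slice_obj[OF assms(2)] z]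
          slice_zero[OF z] assms(2)]] charge_zero[OF z] by simp
qed

text \<open>The charge of the Harder--Narasimhan factor of phase \<open>t\<close>, zero if there is
  none. Expressed by truncations it depends on \<open>y\<close> alone, which is how uniqueness of
  the factors is obtained.\<close>

definition phase_charge :: "real \<Rightarrow> 'o \<Rightarrow> complex" where
  "phase_charge t y = trunc_charge {t..} y - trunc_charge {t<..} y"

lemma HN_inj: "HN_filtration C P y n E A \<phi> \<Longrightarrow> inj_on \<phi> {..<n}"
  unfolding HN_filtration_def inj_on_def by (metis lessThan_iff linorder_neqE_nat less_irrefl)

lemma HN_phase_charge:
  assumes "HN_filtration C P y n E A \<phi>"
  shows "phase_charge t y = (\<Sum>i | i < n \<and> \<phi> i = t. charge (A i))"
proof -
  have "{i. i < n \<and> \<phi> i \<in> {t..}} = {i. i < n \<and> \<phi> i \<in> {t<..}} \<union> {i. i < n \<and> \<phi> i = t}"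
    by auto
  then have "trunc_charge {t..} y =
      trunc_charge {t<..} y + (\<Sum>i | i < n \<and> \<phi> i = t. charge (A i))"
    unfolding HN_trunc_charge[OF upper_atLeast assms] HN_trunc_charge[OF upper_greaterThan assms]
    by (simp, subst sum.union_disjoint) auto
  then show ?thesis unfolding phase_charge_def by simp
qed

lemma HN_phase_charge_factor:
  assumes "HN_filtration C P y n E A \<phi>" "i < n"
  shows "phase_charge (\<phi> i) y = charge (A i)" "phase_charge (\<phi> i) y \<noteq> 0"
proof -
  have "{j. j < n \<and> \<phi> j = \<phi> i} = {i}"
    using HN_inj[OF assms(1)] assms(2) unfolding inj_on_def by auto
  then show "phase_charge (\<phi> i) y = charge (A i)" using HN_phase_charge[OF assms(1)] by simp
  then show "phase_charge (\<phi> i) y \<noteq> 0" using charge_nonzero HN_factor[OF assms] by simp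
qed

text \<open>Factors are semistable and non-zero, hence have non-zero charge, so the phases can be
  read off from \<open>phase_charge\<close>.\<close>

lemma HN_phases:
  assumes "HN_filtration C P y n E A \<phi>"
  shows "{t. phase_charge t y \<noteq> 0} = \<phi> ` {..<n}"
proof (intro equalityI subsetI)
  fix t assume "t \<in> {t. phase_charge t y \<noteq> 0}"
  then have "(\<Sum>i | i < n \<and> \<phi> i = t. charge (A i)) \<noteq> 0" using HN_phase_charge[OF assms] by simp
  then have "{i. i < n \<and> \<phi> i = t} \<noteq> {}" by (metis sum.empty)
  then show "t \<in> \<phi> ` {..<n}" by auto
qed (use HN_phase_charge_factor[OF assms] in auto)

text \<open>The right-hand side does not mention the filtration; this is what makes the definite
  description in \<open>mass\<close> well defined.\<close>

lemma mass_eq_phase_sum: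
  assumes "HN_filtration C P y n E A \<phi>"
  shows "(\<Sum>i<n. q powr \<phi> i * cmod (charge (A i))) =
    (\<Sum>t | phase_charge t y \<noteq> 0. q powr t * cmod (phase_charge t y))"
  unfolding HN_phases[OF assms] sum.reindex[OF HN_inj[OF assms]]
  using HN_phase_charge_factor(1)[OF assms] by simp

lemma mass_HN:
  assumes "HN_filtration C P y n E A \<phi>"
  shows "mass C q (P, Z) y = (\<Sum>i<n. q powr \<phi> i * cmod (charge (A i)))"
  unfolding mass_def fst_conv snd_conv
proof (rule the_equality)
  show "\<exists>n' E' A' \<phi>'. HN_filtration C P y n' E' A' \<phi>' \<and>
      (\<Sum>i<n. q powr \<phi> i * cmod (charge (A i))) =
      (\<Sum>i<n'. q powr \<phi>' i * cmod (charge (A' i)))"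
    using assms by blast
  fix m
  assume "\<exists>n E A \<phi>. HN_filtration C P y n E A \<phi> \<and> m = (\<Sum>i<n. q powr \<phi> i * cmod (charge (A i)))"
  then obtain n' E' A' \<phi>' where "HN_filtration C P y n' E' A' \<phi>'"
    "m = (\<Sum>i<n'. q powr \<phi>' i * cmod (charge (A' i)))" by blast
  then show "m = (\<Sum>i<n. q powr \<phi> i * cmod (charge (A i)))"
    using mass_eq_phase_sum[OF assms, of q] mass_eq_phase_sum[of y n' E' A' \<phi>' q] by simp
qed

text \<open>At a phase outside \<open>I\<close> both truncations would be all of \<open>y\<close>,
  so \<open>phase_charge\<close> would vanish there.\<close>

lemma HN_phase_upper:
  assumes I: "upper I" and y: "y \<in> slice C P I" and HN: "HN_filtration C P y n E A \<phi>" "i < n"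
  shows "\<phi> i \<in> I"
proof (rule ccontr)
  assume n: "\<phi> i \<notin> I"
  then have "I \<subseteq> {\<phi> i<..}" "I \<subseteq> {\<phi> i..}" using upper_greater[OF I] by fastforce+
  then have "phase_charge (\<phi> i) y = 0"
    unfolding phase_charge_def
    using trunc_charge_slice[OF upper_atLeast] trunc_charge_slice[OF upper_greaterThan] y slice_mono
    by simp
  then show False using HN_phase_charge_factor(2)[OF HN] by simp
qed

text \<open>At a phase in \<open>I\<close> both truncations would have charge zero.\<close>

lemma HN_phase_lower:
  assumes I: "upper I" and y: "y \<in> slice C P (- I)" and HN: "HN_filtration C P y n E A \<phi>" "i < n"
  shows "\<phi> i \<notin> I"
proof
  assume n: "\<phi> i \<in> I"
  have "t \<in> I" if "\<phi> i \<le> t" for t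
    using I n that unfolding upper_def by (cases "t = \<phi> i") auto
  then have "{\<phi> i<..} \<subseteq> I" "{\<phi> i..} \<subseteq> I" by auto
  then have "- I \<subseteq> - {\<phi> i<..}" "- I \<subseteq> - {\<phi> i..}" by blast+
  then have "phase_charge (\<phi> i) y = 0"
    unfolding phase_charge_def
    using trunc_charge_Compl[OF upper_atLeast] trunc_charge_Compl[OF upper_greaterThan] y slice_mono
    by simp
  then show False using HN_phase_charge_factor(2)[OF HN] by simp
qed

text \<open>Phases are distinct, so there is at most one factor, and \<open>y\<close> is zero or
  isomorphic to it.\<close>

lemma HN_singleton:
  assumes HN: "HN_filtration C P y n E A \<phi>" and eq: "\<And>i. i < n \<Longrightarrow> \<phi> i = t"
  shows "y \<in> P t"
proof -
  have "n = 0 \<or> n = 1"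
  proof (rule ccontr)
    assume "\<not> ?thesis"
    then have "0 < n" "1 < n" by auto
    then show False using HN_inj[OF HN] eq unfolding inj_on_def by (metis lessThan_iff zero_neq_one)
  qed
  then show ?thesis
  proof
    assume "n = 0"
    then show ?thesis using HN P_zero unfolding HN_filtration_def by auto
  next
    assume n: "n = 1"
    have E: "zero_obj C (E 0)" "E 1 = y" using HN n unfolding HN_filtration_def by auto
    obtain f g h where t: "tri (E 0) y (A 0) f g h" using HN_step[OF HN, of 0] n E by auto
    have "isomorphic C y (A 0)"
      using tri_zero_left_iso[OF t E(1)] t unfolding isomorphic_def tri_def by blast
    then show ?thesis
      using P_isomorphic[OF _ isomorphic_sym] HN_factor(1)[OF HN, of 0] eq[of 0] n by auto
  qed
qed

lemma slice_singleton: "slice C P {t} \<subseteq> P t"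
proof
  fix y assume y: "y \<in> slice C P {t}"
  obtain n E A \<phi> where HN: "HN_filtration C P y n E A \<phi>" using HN_exists[OF slice_obj[OF y]] .
  have "y \<in> slice C P {t..}" "y \<in> slice C P (- {t<..})" using slice_mono[OF y] by auto
  then have "\<phi> i = t" if "i < n" for i
    using HN_phase_upper[OF upper_atLeast _ HN that] HN_phase_lower[OF upper_greaterThan _ HN that]
    by fastforce
  then show "y \<in> P t" using HN_singleton[OF HN] by blast
qed

lemma P_ext: "\<lbrakk>tri x y z f g h; x \<in> P t; z \<in> P t\<rbrakk> \<Longrightarrow> y \<in> P t"
  using slice_ext[of x y z f g h "{t}"] slice_base[of _ t "{t}"] slice_singleton by blast

lemma mass_semistable:
  assumes "y \<in> P t"
  shows "mass C q (P, Z) y = q powr t * cmod (charge y)"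
proof -
  obtain n E A \<phi> where HN: "HN_filtration C P y n E A \<phi>" using HN_exists[OF P_obj[OF assms]] .
  have y: "y \<in> slice C P {t..}" "y \<in> slice C P (- {t<..})" using slice_base[OF assms] by auto
  then have eq: "\<phi> i = t" if "i < n" for i
    using HN_phase_upper[OF upper_atLeast _ HN that] HN_phase_lower[OF upper_greaterThan _ HN that]
    by fastforce
  have "n = 0 \<or> n = 1"
  proof (rule ccontr)
    assume "\<not> ?thesis"
    then have "0 < n" "1 < n" by auto
    then show False using HN_inj[OF HN] eq unfolding inj_on_def by (metis lessThan_iff zero_neq_one)
  qed
  then show ?thesis using mass_HN[OF HN] HN_charge[OF HN] eq by auto
qed

text \<open>Since \<open>x\<close> lies in the upper slice, its map to \<open>y\<close> lifts to the
  truncation \<open>u\<close> of \<open>y\<close>, and the octahedron shows that the cone of the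
  lift truncates \<open>z\<close>.\<close>

lemma trunc_charge_ext:
  assumes I: "upper I" and t: "tri x y z f g h" and x: "x \<in> slice C P I"
  shows "trunc_charge I y = charge x + trunc_charge I z"
proof -
  obtain u v a b c where u: "tri u y v a b c" "u \<in> slice C P I" "v \<in> slice C P (- I)"
    using truncation_exists[OF I tri_obj(2)[OF t]] .
  have H: "f \<in> Hom C x y" "a \<in> Hom C u y" using t u unfolding tri_def by auto
  obtain k where k: "k \<in> Hom C x u" "a \<cdot> k = f" using truncation_lift[OF I u(1,3) H(1) x] .
  obtain p l m where p: "tri x u p k l m" using ex_cone[OF k(1)] .
  have t': "tri x y z (a \<cdot> k) g h" using t k(2) by simp
  obtain a' b' c' where o: "tri p z v a' b' c'" using octahedron[OF p u(1) t'] .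
  have "p \<in> slice C P I"
    using slice_ext[OF tri_rotate[OF p] u(2) slice_upper_shift[OF I x]] .
  then have "trunc_charge I z = charge p" "trunc_charge I y = charge u"
    using trunc_charge_eq[OF I] truncationI o u by blast+
  then show ?thesis using charge_tri[OF p] by simp
qed

text \<open>If \<open>I = {s<..}\<close> and \<open>H\<close> is the cohomology functor of the heart \<open>P (s, s + 1]\<close>, then
  \<open>trunc_charge I r\<close> is the charge of the image of the connecting map from \<open>H z\<close> to \<open>H (x[1])\<close>.\<close>

lemma trunc_charge_defect:
  assumes I: "upper I" and t: "tri x y z f g h"
  obtains r where "r \<in> slice C P (- (\<lambda>t. t + 1) ` I)"
    "trunc_charge I x + trunc_charge I z = trunc_charge I y + trunc_charge I r"
proof -
  obtain u v a b c where u: "tri u x v a b c" "u \<in> slice C P I" "v \<in> slice C P (- I)"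
    using truncation_exists[OF I tri_obj(1)[OF t]] .
  have H: "a \<in> Hom C u x" "f \<in> Hom C x y" using t u unfolding tri_def by auto
  \<comment> \<open>Dividing \<open>y\<close> by the truncation \<open>u\<close> of \<open>x\<close>
    leaves \<open>e\<close>, an extension of \<open>z\<close> by the lower part \<open>v\<close> of
    \<open>x\<close>.\<close>
  obtain e k l where e: "tri u y e (f \<cdot> a) k l" using ex_cone[OF cmp_Hom[OF H]] .
  obtain a1 b1 c1 where e1: "tri v e z a1 b1 c1" using octahedron[OF u(1) t e] .
  have y: "trunc_charge I y = trunc_charge I x + trunc_charge I e"
    using trunc_charge_ext[OF I e u(2)] trunc_charge_eq[OF I truncationI[OF u]] by simp
  obtain p v' a2 b2 c2 where p: "tri p e v' a2 b2 c2" "p \<in> slice C P I" "v' \<in> slice C P (- I)"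
    using truncation_exists[OF I tri_obj(2)[OF e1]] .
  have H': "a2 \<in> Hom C p e" "b1 \<in> Hom C e z" using p e1 unfolding tri_def by auto
  \<comment> \<open>The truncation \<open>p\<close> of \<open>e\<close> maps to \<open>z\<close>
    through \<open>e\<close>. By the octahedron the cone \<open>r\<close> is an extension of v[1] by
    \<open>v'\<close>, neither of which has phases in \<open>I\<close> shifted by one.\<close>
  obtain r k' l' where r: "tri p z r (b1 \<cdot> a2) k' l'" using ex_cone[OF cmp_Hom[OF H']] .
  obtain a3 b3 c3 where r1: "tri v' r (shift_obj C v) a3 b3 c3"
    using octahedron[OF p(1) tri_rotate[OF e1] r] .
  have z: "trunc_charge I z = trunc_charge I e + trunc_charge I r"
    using trunc_charge_ext[OF I r p(2)] trunc_charge_eq[OF I truncationI[OF p]] by simp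
  have "(\<lambda>t. t + 1) ` (- I) \<subseteq> - (\<lambda>t. t + 1) ` I" by auto
  then have "shift_obj C v \<in> slice C P (- (\<lambda>t. t + 1) ` I)"
    using slice_mono[OF slice_shift[OF u(3)]] by blast
  moreover have "v' \<in> slice C P (- (\<lambda>t. t + 1) ` I)"
    using slice_mono[OF p(3)] upper_shift[OF I] by blast
  ultimately have "r \<in> slice C P (- (\<lambda>t. t + 1) ` I)" using slice_ext[OF r1] by blast
  then show ?thesis using that y z by (simp add: algebra_simps)
qed

end

section \<open>A subadditive minorant of the mass\<close>

lemma trig_less_exp_pos:
  fixes c v :: real
  assumes "0 < v" "v < pi"
  shows "cos v + c * sin v < exp (c * v)"
proof -
  \<comment> \<open>The exponential factor turns the claim into \<open>?g v < ?g 0\<close>, with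
    \<open>?g 0\<close> equal to 1; the derivative collapses to a negative multiple of the
    sine.\<close>
  let ?g = "\<lambda>v. exp (- c * v) * (cos v + c * sin v)"
  have "?g v < ?g 0"
  proof (rule DERIV_neg_imp_decreasing_open[OF assms(1)])
    fix x assume x: "0 < x" "x < v"
    have "(?g has_real_derivative
        exp (- c * x) * (- c) * (cos x + c * sin x) + exp (- c * x) * (- sin x + c * cos x)) (at x)"
      by (auto intro!: derivative_eq_intros)
    moreover have "exp (- c * x) * (- c) * (cos x + c * sin x) + exp (- c * x) * (- sin x + c * cos x)
        = - (exp (- c * x) * (1 + c\<^sup>2) * sin x)"
      by (simp add: algebra_simps power2_eq_square)
    moreover have "0 < exp (- c * x) * (1 + c\<^sup>2) * sin x"
      using sin_gt_zero[of x] x assms by (simp add: add_pos_nonneg)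
    ultimately show "\<exists>y. (?g has_real_derivative y) (at x) \<and> y < 0" by force
  qed (auto intro!: continuous_intros)
  then have "?g v < 1" by simp
  have "cos v + c * sin v = exp (c * v) * exp (- c * v) * (cos v + c * sin v)"
    by (simp flip: exp_add)
  also have "\<dots> = exp (c * v) * ?g v" by (simp only: mult.assoc)
  also have "\<dots> < exp (c * v) * 1"
    using \<open>?g v < 1\<close> by (intro mult_strict_left_mono) auto
  finally show ?thesis by simp
qed

text \<open>For negative \<open>v\<close>, change the signs of both \<open>v\<close> and
  \<open>c\<close>.\<close>

lemma trig_less_exp:
  fixes c v :: real
  assumes "v \<noteq> 0" "\<bar>v\<bar> < pi"
  shows "cos v + c * sin v < exp (c * v)"
  using trig_less_exp_pos[of v c] trig_less_exp_pos[of "- v" "- c"] assms by (cases "v > 0") auto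

text \<open>The exponential rotates the ray of phase \<phi> onto the positive reals. The coefficient
  \<open>ln q / pi\<close> makes the derivative in the phase at \<phi> equal to that of
  \<open>q powr t\<close>.\<close>

definition support :: "real \<Rightarrow> real \<Rightarrow> complex \<Rightarrow> real" where
  "support q \<phi> w = q powr \<phi> *
     (Re (w * exp (- (\<i> * pi * \<phi>))) + ln q / pi * Im (w * exp (- (\<i> * pi * \<phi>))))"

text \<open>With d the arctangent of \<open>ln q / pi\<close>, the functional on the ray of phase t
  is proportional to cos (pi (t - \<phi>) - d); this is its zero just below \<phi>.\<close>

definition support_start :: "real \<Rightarrow> real \<Rightarrow> real" where
  "support_start q \<phi> = \<phi> + arctan (ln q / pi) / pi - 1 / 2"

lemma support_start_bounds: "support_start q \<phi> < \<phi> \<and> \<phi> < support_start q \<phi> + 1"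
proof -
  have "arctan (ln q / pi) / pi < 1 / 2"
    using arctan_bounded[of "ln q / pi"] by (simp add: divide_less_eq)
  moreover have "- (1 / 2) < arctan (ln q / pi) / pi"
    using arctan_bounded[of "ln q / pi"] by (subst less_divide_eq) simp
  ultimately show ?thesis unfolding support_start_def by linarith
qed

lemma support_add: "support q \<phi> (w + w') = support q \<phi> w + support q \<phi> w'"
  and support_diff: "support q \<phi> (w - w') = support q \<phi> w - support q \<phi> w'"
  and support_zero: "support q \<phi> 0 = 0"
  by (simp_all add: support_def algebra_simps add_divide_distrib diff_divide_distrib)

lemma support_sum: "support q \<phi> (\<Sum>i\<in>I. f i) = (\<Sum>i\<in>I. support q \<phi> (f i))"
  by (induction I rule: infinite_finite_induct) (simp_all add: support_add support_zero)

lemma support_phase: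
  "support q \<phi> (of_real r * exp (\<i> * pi * t)) =
     q powr \<phi> * r * (cos (pi * (t - \<phi>)) + ln q / pi * sin (pi * (t - \<phi>)))"
proof -
  have eq: "of_real r * exp (\<i> * pi * t) * exp (- (\<i> * pi * \<phi>)) =
      of_real r * cis (pi * (t - \<phi>))"
    by (simp add: cis_conv_exp mult.assoc algebra_simps flip: exp_add)
  show ?thesis unfolding support_def eq by (simp add: distrib_left)
qed

lemma support_less:
  assumes "q > 0" "r > 0" "t \<noteq> \<phi>" "\<bar>t - \<phi>\<bar> < 1"
  shows "support q \<phi> (of_real r * exp (\<i> * pi * t)) < q powr t * r"
proof -
  have "\<bar>pi * (t - \<phi>)\<bar> < pi" using assms(4) by (simp add: abs_mult)
  then have "cos (pi * (t - \<phi>)) + ln q / pi * sin (pi * (t - \<phi>)) < exp (ln q / pi * (pi * (t - \<phi>)))"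
    using trig_less_exp[of "pi * (t - \<phi>)" "ln q / pi"] assms(3) by simp
  also have "\<dots> = q powr (t - \<phi>)" using assms(1) by (simp add: powr_def mult.commute)
  finally have "q powr \<phi> * r * (cos (pi * (t - \<phi>)) + ln q / pi * sin (pi * (t - \<phi>))) <
      q powr \<phi> * r * q powr (t - \<phi>)"
    using assms by simp
  also have "\<dots> = q powr t * r" by (simp add: powr_diff assms)
  finally show ?thesis unfolding support_phase .
qed

text \<open>A single sine replaces the sum, so that the sign on each unit interval of phases is
  visible.\<close>

lemma support_phase_sin:
  "support q \<phi> (of_real r * exp (\<i> * pi * t)) =
     q powr \<phi> * r * sin (pi * (t - support_start q \<phi>)) / cos (arctan (ln q / pi))"
proof -
  define d where "d = arctan (ln q / pi)"
  have d: "cos d \<noteq> 0" "ln q / pi = sin d / cos d"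
    unfolding d_def using cos_arctan_not_zero tan_arctan[of "ln q / pi"] by (auto simp: tan_def)
  have "pi * (t - support_start q \<phi>) = pi * (t - \<phi>) - d + pi / 2"
    unfolding support_start_def d_def by (simp add: field_simps)
  then have "sin (pi * (t - support_start q \<phi>)) = cos (pi * (t - \<phi>) - d)"
    by (simp add: sin_add)
  also have "\<dots> = cos d * (cos (pi * (t - \<phi>)) + ln q / pi * sin (pi * (t - \<phi>)))"
    unfolding cos_diff using d by (simp add: distrib_left)
  finally show ?thesis unfolding support_phase d_def[symmetric] using d(1) by simp
qed

lemma support_nonneg:
  assumes "r \<ge> 0" "support_start q \<phi> < t" "t \<le> support_start q \<phi> + 1"
  shows "0 \<le> support q \<phi> (of_real r * exp (\<i> * pi * t))"
proof -
  have "0 \<le> sin (pi * (t - support_start q \<phi>))"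
    using assms by (intro sin_ge_zero) (auto simp: mult_le_cancel_left1)
  moreover have "0 < cos (arctan (ln q / pi))"
    using arctan_bounded[of "ln q / pi"] cos_gt_zero_pi by simp
  ultimately show ?thesis unfolding support_phase_sin using assms by simp
qed

lemma support_nonpos:
  assumes "r \<ge> 0" "support_start q \<phi> + 1 < t" "t \<le> support_start q \<phi> + 2"
  shows "support q \<phi> (of_real r * exp (\<i> * pi * t)) \<le> 0"
proof -
  have "0 \<le> sin (pi * (t - 1 - support_start q \<phi>))"
    using assms by (intro sin_ge_zero) (auto simp: mult_le_cancel_left1)
  moreover have "pi * (t - support_start q \<phi>) = pi * (t - 1 - support_start q \<phi>) + pi"
    by (simp add: algebra_simps)
  ultimately have "sin (pi * (t - support_start q \<phi>)) \<le> 0" by simp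
  moreover have "0 < cos (arctan (ln q / pi))"
    using arctan_bounded[of "ln q / pi"] cos_gt_zero_pi by simp
  ultimately show ?thesis unfolding support_phase_sin using assms
    by (simp add: divide_nonpos_pos mult_nonneg_nonpos)
qed

section \<open>The minorant on objects\<close>

context stability
begin

text \<open>The argument of \<open>support\<close> is the charge of the cohomology of \<open>y\<close> in the heart \<open>P (s, s + 1]\<close>.\<close>

definition support_mass :: "real \<Rightarrow> real \<Rightarrow> 'o \<Rightarrow> real" where
  "support_mass q \<phi> y = support q \<phi>
     (trunc_charge {support_start q \<phi><..} y - trunc_charge {support_start q \<phi> + 1<..} y)"

lemma shift_greaterThan: "(\<lambda>t. t + 1) ` {s<..} = {s + 1<..}" for s :: real
proof (intro equalityI subsetI)
  fix x assume "x \<in> {s + 1<..}"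
  then show "x \<in> (\<lambda>t. t + 1) ` {s<..}" by (intro image_eqI[of _ _ "x - 1"]) auto
qed auto

lemma support_trunc_charge:
  assumes HN: "HN_filtration C P y n E A \<theta>" and I: "upper I"
  shows "support q \<phi> (trunc_charge I y) =
    (\<Sum>i | i < n \<and> \<theta> i \<in> I. support q \<phi> (of_real (cmod (charge (A i))) * exp (\<i> * pi * \<theta> i)))"
  unfolding HN_trunc_charge[OF I HN] support_sum
  by (intro sum.cong refl) (metis (no_types, lifting) HN HN_factor(1) charge_phase' mem_Collect_eq)

text \<open>The defect of truncation is taken at both ends of the heart. The one at s has phases in
  (s, s + 1], where \<open>support\<close> is nonnegative; the one at s + 1 has phases in (s + 1, s
  + 2], where it is nonpositive and enters with a minus sign.\<close>

lemma support_mass_subadditive: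
  assumes t: "tri x y z f g h"
  shows "support_mass q \<phi> y \<le> support_mass q \<phi> x + support_mass q \<phi> z"
proof -
  let ?s = "support_start q \<phi>"
  obtain r where r: "r \<in> slice C P (- {?s + 1<..})"
    "trunc_charge {?s<..} x + trunc_charge {?s<..} z = trunc_charge {?s<..} y + trunc_charge {?s<..} r"
    using trunc_charge_defect[OF upper_greaterThan t, of ?s] shift_greaterThan by metis
  obtain r' where r': "r' \<in> slice C P (- {?s + 1 + 1<..})"
    "trunc_charge {?s + 1<..} x + trunc_charge {?s + 1<..} z =
      trunc_charge {?s + 1<..} y + trunc_charge {?s + 1<..} r'"
    using trunc_charge_defect[OF upper_greaterThan t, of "?s + 1"] shift_greaterThan by metis
  have "0 \<le> support q \<phi> (trunc_charge {?s<..} r)"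
  proof -
    obtain n E A \<theta> where HN: "HN_filtration C P r n E A \<theta>" using HN_exists[OF slice_obj[OF r(1)]] .
    show ?thesis
      unfolding support_trunc_charge[OF HN upper_greaterThan]
      using HN_phase_lower[OF upper_greaterThan r(1) HN]
      by (intro sum_nonneg support_nonneg) (auto simp: not_less)
  qed
  moreover have "support q \<phi> (trunc_charge {?s + 1<..} r') \<le> 0"
  proof -
    obtain n E A \<theta> where HN: "HN_filtration C P r' n E A \<theta>" using HN_exists[OF slice_obj[OF r'(1)]] .
    show ?thesis
      unfolding support_trunc_charge[OF HN upper_greaterThan]
      using HN_phase_lower[OF upper_greaterThan r'(1) HN]
      by (intro sum_nonpos support_nonpos) (auto simp: not_less add.commute)
  qed
  ultimately show ?thesis
    using arg_cong[OF r(2), of "support q \<phi>"] arg_cong[OF r'(2), of "support q \<phi>"]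
    unfolding support_mass_def support_add support_diff by linarith
qed

text \<open>Both sides are sums over the Harder--Narasimhan factors and are compared term by term; a
  term is strictly smaller unless its phase is \<phi>, so equality leaves only the phase
  \<phi>.\<close>

lemma support_mass_le:
  assumes q: "q > 0" and y: "y \<in> obj C"
  shows "support_mass q \<phi> y \<le> mass C q (P, Z) y"
    and "support_mass q \<phi> y = mass C q (P, Z) y \<Longrightarrow> y \<in> P \<phi>"
proof -
  let ?s = "support_start q \<phi>"
  obtain n E A \<theta> where HN: "HN_filtration C P y n E A \<theta>" using HN_exists[OF y] .
  define S where "S i = support q \<phi> (of_real (cmod (charge (A i))) * exp (\<i> * pi * \<theta> i))" for i
  define m where "m i = q powr \<theta> i * cmod (charge (A i))" for i
  \<comment> \<open>The share of factor \<open>i\<close>: the difference of the two truncations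
    keeps only the phases of the heart.\<close>
  define h where "h i = (if ?s < \<theta> i \<and> \<theta> i \<le> ?s + 1 then S i else 0)" for i
  have pos: "0 < cmod (charge (A i))" if "i < n" for i
    using charge_nonzero HN_factor[OF HN that] by simp
  have "support_mass q \<phi> y =
      (\<Sum>i | i < n \<and> \<theta> i \<in> {?s<..}. S i) - (\<Sum>i | i < n \<and> \<theta> i \<in> {?s + 1<..}. S i)"
    unfolding support_mass_def support_diff S_def support_trunc_charge[OF HN upper_greaterThan] ..
  also have "\<dots> = (\<Sum>i | i < n \<and> ?s < \<theta> i \<and> \<theta> i \<le> ?s + 1. S i)"
  proof -
    have split: "{i. i < n \<and> \<theta> i \<in> {?s<..}} =
        {i. i < n \<and> ?s < \<theta> i \<and> \<theta> i \<le> ?s + 1} \<union> {i. i < n \<and> \<theta> i \<in> {?s + 1<..}}" by auto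
    have "(\<Sum>i | i < n \<and> \<theta> i \<in> {?s<..}. S i) =
        (\<Sum>i | i < n \<and> ?s < \<theta> i \<and> \<theta> i \<le> ?s + 1. S i) + (\<Sum>i | i < n \<and> \<theta> i \<in> {?s + 1<..}. S i)"
      unfolding split by (rule sum.union_disjoint) auto
    then show ?thesis by simp
  qed
  also have "\<dots> = (\<Sum>i<n. h i)"
    unfolding h_def by (subst sum.inter_filter[symmetric]) (auto intro: sum.cong)
  finally have N: "support_mass q \<phi> y = (\<Sum>i<n. h i)" .
  have M: "mass C q (P, Z) y = (\<Sum>i<n. m i)" unfolding m_def by (rule mass_HN[OF HN])
  have less: "h i < m i" if "i < n" "\<theta> i \<noteq> \<phi>" for i
  proof (cases "?s < \<theta> i \<and> \<theta> i \<le> ?s + 1")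
    case True
    then have "\<bar>\<theta> i - \<phi>\<bar> < 1" using support_start_bounds[of q \<phi>] by linarith
    then show ?thesis using support_less[OF q pos[OF that(1)] that(2)] True unfolding h_def S_def m_def by simp
  next
    case False
    then show ?thesis using pos[OF that(1)] q unfolding h_def m_def by (auto simp del: zero_less_norm_iff)
  qed
  have le: "h i \<le> m i" if "i < n" for i
  proof (cases "\<theta> i = \<phi>")
    case True
    then have "h i = m i"
      unfolding h_def S_def m_def support_phase using support_start_bounds[of q \<phi>] by simp
    then show ?thesis by simp
  qed (use less[OF that] in simp)
  show "support_mass q \<phi> y \<le> mass C q (P, Z) y" unfolding N M using le by (intro sum_mono) simp
  assume "support_mass q \<phi> y = mass C q (P, Z) y"
  then have "\<not> (\<exists>i<n. h i < m i)"
    unfolding N M using le sum_strict_mono_ex1[of "{..<n}" h m] by fastforce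
  then show "y \<in> P \<phi>" using less HN_singleton[OF HN] by blast
qed

lemma support_mass_semistable:
  assumes "y \<in> P \<phi>"
  shows "support_mass q \<phi> y = mass C q (P, Z) y"
proof -
  let ?s = "support_start q \<phi>"
  have "y \<in> slice C P {?s<..}" "y \<in> slice C P (- {?s + 1<..})"
    using support_start_bounds[of q \<phi>] by (auto intro!: slice_base[OF assms])
  then have "support_mass q \<phi> y = support q \<phi> (charge y)"
    unfolding support_mass_def
    using trunc_charge_slice[OF upper_greaterThan] trunc_charge_Compl[OF upper_greaterThan] by simp
  also have "\<dots> = q powr \<phi> * cmod (charge y)"
    by (subst charge_phase'[OF assms], subst support_phase) simp
  finally show ?thesis using mass_semistable[OF assms] by simp
qed

end

section \<open>Stable filtrations of semistable objects\<close>

context triangulated_category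
begin

text \<open>The zero map \<open>f\<close> kills the identity of \<open>x\<close>, while the
  orthogonality makes \<open>f\<close> left cancellable.\<close>

lemma tri_zero_map:
  assumes t: "tri x y z f g h" and f: "f = arr_zero C x y" and o: "orth (shift_obj C x) z"
  shows "zero_obj C x"
proof -
  have H: "f \<in> Hom C x y" using t unfolding tri_def by blast
  have "idm C x = arr_zero C x x"
    using tri_left_cancel_zero[OF t o idm_Hom] cmp_idm_right[OF H] f tri_obj(1)[OF t] by simp
  then show ?thesis using zero_obj_iff tri_obj(1)[OF t] by blast
qed

lemma monic_inD:
  assumes "monic_in C A f"
  shows "f \<in> Hom C (src C f) (tgt C f)" "src C f \<in> A" "tgt C f \<in> A"
    "\<lbrakk>w \<in> A; g \<in> Hom C w (src C f); h \<in> Hom C w (src C f); f \<cdot> g = f \<cdot> h\<rbrakk> \<Longrightarrow> g = h"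
  using assms unfolding monic_in_def Hom_def by auto

lemma monic_inI:
  assumes "f \<in> Hom C x y" "x \<in> A" "y \<in> A"
    and "\<And>w g h. \<lbrakk>w \<in> A; g \<in> Hom C w x; h \<in> Hom C w x; f \<cdot> g = f \<cdot> h\<rbrakk> \<Longrightarrow> g = h"
  shows "monic_in C A f"
  using assms Hom_src[OF assms(1)] Hom_tgt[OF assms(1)] Hom_arr[OF assms(1)]
  unfolding monic_in_def by metis

lemma monic_in_cmp:
  assumes f: "monic_in C A f" and k: "monic_in C A k" "tgt C k = src C f"
  shows "monic_in C A (f \<cdot> k)" "src C (f \<cdot> k) = src C k" "tgt C (f \<cdot> k) = tgt C f"
proof -
  have H: "k \<in> Hom C (src C k) (src C f)" "f \<in> Hom C (src C f) (tgt C f)"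
    using monic_inD(1)[OF f] monic_inD(1)[OF k(1)] k(2) by auto
  have c: "f \<cdot> k \<in> Hom C (src C k) (tgt C f)" using cmp_Hom[OF H] .
  show "monic_in C A (f \<cdot> k)"
  proof (rule monic_inI[OF c monic_inD(2)[OF k(1)] monic_inD(3)[OF f]])
    fix w g h
    assume w: "w \<in> A" "g \<in> Hom C w (src C k)" "h \<in> Hom C w (src C k)" "(f \<cdot> k) \<cdot> g = (f \<cdot> k) \<cdot> h"
    then have "f \<cdot> (k \<cdot> g) = f \<cdot> (k \<cdot> h)"
      using cmp_assoc[OF w(2) H] cmp_assoc[OF w(3) H] by simp
    then have "k \<cdot> g = k \<cdot> h"
      using monic_inD(4)[OF f w(1) cmp_Hom[OF w(2) H(1)] cmp_Hom[OF w(3) H(1)]] by blast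
    then show "g = h" using monic_inD(4)[OF k(1) w(1,2,3)] by blast
  qed
  show "src C (f \<cdot> k) = src C k" "tgt C (f \<cdot> k) = tgt C f"
    using Hom_src[OF c] Hom_tgt[OF c] by auto
qed

lemma monic_in_retract_iso:
  assumes k: "monic_in C A k" and l: "l \<in> Hom C (tgt C k) (src C k)" "k \<cdot> l = idm C (tgt C k)"
    and obj: "A \<subseteq> obj C"
  shows "is_iso C k"
proof (rule is_isoI[OF monic_inD(1)[OF k] l(1) _ l(2)])
  note H = monic_inD(1)[OF k]
  have "k \<cdot> (l \<cdot> k) = k \<cdot> idm C (src C k)"
    using cmp_assoc[OF H l(1) H] l(2) cmp_idm_left[OF H] cmp_idm_right[OF H] by simp
  then show "l \<cdot> k = idm C (src C k)"
    using monic_inD(4)[OF k monic_inD(2)[OF k] cmp_Hom[OF H l(1)] idm_Hom] monic_inD(2)[OF k] obj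
    by blast
qed

end

section \<open>Subobjects and chain conditions in one phase\<close>

context stability
begin

lemma charge_rotated:
  assumes "a \<in> P t"
  shows "Im (charge a * exp (- (\<i> * pi * \<phi>))) = cmod (charge a) * sin (pi * (t - \<phi>))"
proof -
  have "charge a * exp (- (\<i> * pi * \<phi>)) = of_real (cmod (charge a)) * cis (pi * (t - \<phi>))"
    by (subst charge_phase'[OF assms]) (simp add: cis_conv_exp mult.assoc algebra_simps flip: exp_add)
  then show ?thesis by simp
qed

text \<open>The cone separates into a part of phase \<phi>, the would-be cokernel, and a part of
  phase \<phi> + 1, the shift of the would-be kernel.\<close>

lemma cone_phases:
  assumes t: "tri e x c f g h" and P: "e \<in> P \<phi>" "x \<in> P \<phi>"
    and HN: "HN_filtration C P c n E A \<theta>" and i: "i < n"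
  shows "\<theta> i = \<phi> \<or> \<theta> i = \<phi> + 1"
proof -
  have "c \<in> slice C P {\<phi>..}" "c \<in> slice C P (- {\<phi> + 1<..})"
    using slice_ext[OF tri_rotate[OF t]] slice_base[OF P(2)] slice_base[OF P_shift_obj[OF P(1)]] by auto
  then have b: "\<phi> \<le> \<theta> j" "\<theta> j \<le> \<phi> + 1" if "j < n" for j
    using HN_phase_upper[OF upper_atLeast _ HN that] HN_phase_lower[OF upper_greaterThan _ HN that]
    by fastforce+
  \<comment> \<open>The charge of \<open>c\<close> lies on the real line of phase \<open>\<phi>\<close>, while the factors of \<open>c\<close> lie in the closed
    half-plane on one side of it; so they all lie on the line.\<close>
  define s where "s j = cmod (charge (A j)) * sin (pi * (\<theta> j - \<phi>))" for j
  have nn: "0 \<le> s j" if "j < n" for j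
    unfolding s_def using b[OF that] by (intro mult_nonneg_nonneg sin_ge_zero) (auto simp: mult_le_cancel_left1)
  have "charge c = charge x - charge e" using charge_tri[OF t] by simp
  then have "Im (charge c * exp (- (\<i> * pi * \<phi>))) = 0"
    using charge_rotated[OF P(1), of \<phi>] charge_rotated[OF P(2), of \<phi>]
    by (simp only: left_diff_distrib minus_complex.sel) simp
  moreover have "charge c * exp (- (\<i> * pi * \<phi>)) = (\<Sum>j<n. charge (A j) * exp (- (\<i> * pi * \<phi>)))"
    unfolding HN_charge[OF HN] sum_distrib_right ..
  ultimately have "(\<Sum>j<n. Im (charge (A j) * exp (- (\<i> * pi * \<phi>)))) = 0"
    by (simp only: Im_sum[symmetric])
  moreover have "(\<Sum>j<n. Im (charge (A j) * exp (- (\<i> * pi * \<phi>)))) = (\<Sum>j<n. s j)"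
    unfolding s_def using charge_rotated[OF HN_factor(1)[OF HN]] by (intro sum.cong) simp_all
  ultimately have "(\<Sum>j<n. s j) = 0" by simp
  then have "s i = 0" using sum_nonneg_eq_0_iff[of "{..<n}" s] nn i by auto
  then have "sin (pi * (\<theta> i - \<phi>)) = 0"
    unfolding s_def using charge_nonzero HN_factor[OF HN i] by simp
  moreover have "0 < sin (pi * (\<theta> i - \<phi>))" if "\<phi> < \<theta> i" "\<theta> i < \<phi> + 1"
    using that by (intro sin_gt_zero) auto
  ultimately show ?thesis using b[OF i] by fastforce
qed

text \<open>A factor of phase \<phi> + 1 would be the shift of a kernel of \<open>f\<close>.
  Monicity kills the map from that kernel to \<open>e\<close>, which forces the factor to
  vanish.\<close>

lemma monic_cone:
  assumes f: "monic_in C (P \<phi>) f" and t: "tri e x c f g h"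
  shows "c \<in> P \<phi>"
proof -
  have H: "f \<in> Hom C e x" "g \<in> Hom C x c" "h \<in> Hom C c (shift_obj C e)"
    using t unfolding tri_def by auto
  have P: "e \<in> P \<phi>" "x \<in> P \<phi>" using monic_inD(2,3)[OF f] Hom_src[OF H(1)] Hom_tgt[OF H(1)] by auto
  obtain n E A \<theta> where HN: "HN_filtration C P c n E A \<theta>" using HN_exists[OF tri_obj(3)[OF t]] .
  have "\<theta> i = \<phi>" if "i < n" for i
  proof (rule ccontr)
    assume "\<theta> i \<noteq> \<phi>"
    moreover have n: "0 < n" using that by simp
    moreover have dec: "\<theta> j < \<theta> 0" if "0 < j" "j < n" for j
      using HN that unfolding HN_filtration_def by blast
    ultimately have top: "\<theta> 0 = \<phi> + 1"
      using cone_phases[OF t P HN that] cone_phases[OF t P HN n] dec[OF _ that] by (cases "i = 0") auto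
    have low: "\<theta> j \<in> - {\<phi><..}" if "1 \<le> j" "j < n" for j
      using cone_phases[OF t P HN that(2)] dec[of j] that top by auto
    obtain a b d where s: "tri (E 0) (E 1) (A 0) a b d" using HN_step[OF HN n] by auto
    have "zero_obj C (E 0)" using HN unfolding HN_filtration_def by blast
    then have iso: "isomorphic C (E 1) (A 0)"
      using tri_zero_left_iso[OF s] s unfolding isomorphic_def tri_def by blast
    then have E1: "E 1 \<in> P (\<phi> + 1)"
      using P_isomorphic[OF _ isomorphic_sym] HN_factor(1)[OF HN n] top by simp
    then obtain k where k: "k \<in> P \<phi>" "isomorphic C (shift_obj C k) (E 1)"
      unfolding P_shift iso_closure_def by blast
    obtain \<alpha> \<beta> where \<alpha>: "\<alpha> \<in> Hom C (shift_obj C k) (E 1)" "\<beta> \<in> Hom C (E 1) (shift_obj C k)"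
      "\<alpha> \<cdot> \<beta> = idm C (E 1)"
      using k(2) unfolding isomorphic_def by (meson is_isoE)
    obtain r m m' m'' where r: "r \<in> slice C P (- {\<phi><..})" "tri (E 1) c r m m' m''"
      using HN_quotient[OF HN _ low Compl_upper_nonempty[OF upper_greaterThan], of 1] n
      by (auto simp: Suc_le_eq)
    have m: "m \<in> Hom C (E 1) c" using r(2) unfolding tri_def by blast
    note p = cmp_Hom[OF \<alpha>(1) m]
    \<comment> \<open>The unshifted connecting map on the candidate kernel \<open>k\<close>; the
      next lines show that \<open>f\<close> kills it.\<close>
    obtain j where j: "j \<in> Hom C k e" "h \<cdot> (m \<cdot> \<alpha>) = shift_arr C j"
      using shift_full[OF cmp_Hom[OF p H(3)] P_obj[OF k(1)] P_obj[OF P(1)]] by blast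
    have "shift_arr C (f \<cdot> j) = shift_arr C f \<cdot> (h \<cdot> (m \<cdot> \<alpha>))"
      using shift_cmp[OF j(1) H(1)] j(2) by simp
    also have "\<dots> = (shift_arr C f \<cdot> h) \<cdot> (m \<cdot> \<alpha>)"
      using cmp_assoc[OF p H(3) shift_Hom[OF H(1)]] by simp
    also have "\<dots> = arr_zero C (shift_obj C k) (shift_obj C x)"
      using tri_cmp_zero'(2)[OF t] cmp_zero_left[OF p] shift_obj P_obj[OF P(2)] by simp
    also have "\<dots> = shift_arr C (f \<cdot> arr_zero C k e)"
      using shift_zero cmp_zero_right[OF H(1)] P_obj[OF k(1)] P_obj[OF P(2)] by simp
    finally have "f \<cdot> j = f \<cdot> arr_zero C k e"
      using shift_inj[OF cmp_Hom[OF j(1) H(1)] cmp_Hom[OF arr_zero_Hom H(1)]]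
        P_obj[OF k(1)] P_obj[OF P(1)] by blast
    then have "j = arr_zero C k e"
      using monic_inD(4)[OF f k(1)] j(1) arr_zero_Hom[OF P_obj[OF k(1)] P_obj[OF P(1)]] Hom_src[OF H(1)]
      by simp
    then have "h \<cdot> (m \<cdot> \<alpha>) = arr_zero C (shift_obj C k) (shift_obj C e)"
      using j(2) shift_zero P_obj[OF k(1)] P_obj[OF P(1)] by simp
    \<comment> \<open>With the connecting map zero, the map from k[1] to \<open>c\<close> lifts to
      \<open>x\<close>, where it vanishes by phase.\<close>
    then obtain l where l: "l \<in> Hom C (shift_obj C k) x" "g \<cdot> l = m \<cdot> \<alpha>"
      using exact_left[OF tri_rotate[OF t] p] by blast
    have "orth (shift_obj C k) x" using P_orth[OF P_shift_obj[OF k(1)] P(2)] by simp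
    then have "m \<cdot> \<alpha> = arr_zero C (shift_obj C k) c"
      using l cmp_zero_right[OF H(2)] unfolding orth_def by metis
    moreover have "(m \<cdot> \<alpha>) \<cdot> \<beta> = m" using cmp_assoc[OF \<alpha>(2,1) m] \<alpha>(3) cmp_idm_right[OF m] by simp
    ultimately have "m = arr_zero C (E 1) c" using cmp_zero_left[OF \<alpha>(2) tri_obj(3)[OF t]] by simp
    \<comment> \<open>The quotient \<open>r\<close> has phases at most \<phi>, so a zero map from
      \<open>E 1\<close> can occur in the triangle only if \<open>E 1\<close> is zero.\<close>
    moreover have "orth (shift_obj C (E 1)) r"
      using slice_Compl_orth[OF upper_greaterThan slice_base[OF P_shift_obj[OF E1]] r(1)] by simp
    ultimately have "zero_obj C (E 1)" using tri_zero_map[OF r(2)] by blast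
    then show False using zero_obj_isomorphic[OF iso] HN_factor(2)[OF HN n] by blast
  qed
  then show ?thesis using HN_singleton[OF HN] by blast
qed

lemma cone_monic:
  assumes t: "tri e x c f g h" and P: "e \<in> P \<phi>" "x \<in> P \<phi>" "c \<in> P \<phi>"
  shows "monic_in C (P \<phi>) f"
proof (rule monic_inI[OF _ P(1,2)])
  show "f \<in> Hom C e x" using t unfolding tri_def by blast
  fix w j k assume w: "w \<in> P \<phi>" "j \<in> Hom C w e" "k \<in> Hom C w e" "f \<cdot> j = f \<cdot> k"
  have "orth (shift_obj C w) c" using P_orth[OF P_shift_obj[OF w(1)] P(3)] by simp
  then show "j = k" using tri_left_cancel[OF t _ w(2,3,4)] by blast
qed

text \<open>Local finiteness concerns strict subobjects in a thin slice. The triangle on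
  \<open>f\<close> supplies kernel and cokernel there: exactness gives existence, and since the
  interval is shorter than 1, the shift rules out the maps that would spoil uniqueness.\<close>

lemma monic_strict:
  assumes f: "monic_in C (P \<phi>) f" and \<eta>: "0 < \<eta>" "\<eta> < 1 / 2"
  shows "strict_monic_in C (slice C P {\<phi> - \<eta><..<\<phi> + \<eta>}) f"
proof -
  let ?A = "slice C P {\<phi> - \<eta><..<\<phi> + \<eta>}"
  define e x where "e = src C f" "x = tgt C f"
  have fH: "f \<in> Hom C e x" using monic_inD(1)[OF f] unfolding e_x_def .
  obtain c g h where t: "tri e x c f g h" using ex_cone[OF fH] .
  have P: "e \<in> P \<phi>" "x \<in> P \<phi>" "c \<in> P \<phi>"
    using monic_inD[OF f] monic_cone[OF f t] unfolding e_x_def by auto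
  have A: "e \<in> ?A" "x \<in> ?A" "c \<in> ?A" using slice_base P \<eta> by auto
  have gH: "g \<in> Hom C x c" using t unfolding tri_def by blast
  have o1: "orth (shift_obj C e) w" if "w \<in> ?A" for w
    by (rule slice_orth[OF slice_base[OF P_shift_obj[OF P(1)] singletonI] that]) (use \<eta> in auto)
  have o2: "orth (shift_obj C w) c" if "w \<in> ?A" for w
    by (rule slice_orth[OF slice_shift[OF that] slice_base[OF P(3) singletonI]]) (use \<eta> in auto)
  have "\<exists>!k. k \<in> Hom C c w \<and> k \<cdot> g = p" if "w \<in> ?A" "p \<in> Hom C x w" "p \<cdot> f = arr_zero C e w" for w p
    using exact_right[OF t that(2,3)] tri_right_cancel[OF t o1[OF that(1)]] by metis
  moreover have "\<exists>!k. k \<in> Hom C w e \<and> f \<cdot> k = p" if "w \<in> ?A" "p \<in> Hom C w x" "g \<cdot> p = arr_zero C w c" for w p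
    using exact_left[OF t that(2,3)] tri_left_cancel[OF t o2[OF that(1)]] by metis
  ultimately have "cokernel_in C ?A f g \<and> kernel_in C ?A g f"
    unfolding cokernel_in_def kernel_in_def
    using A tri_cmp_zero[OF t] Hom_arr[OF fH] Hom_arr[OF gH] Hom_src[OF fH] Hom_src[OF gH]
      Hom_tgt[OF fH] Hom_tgt[OF gH] by simp
  then show ?thesis unfolding strict_monic_in_def by blast
qed

text \<open>Descending chains serve to find stable subobjects, ascending ones to exhaust an object
  by them.\<close>

lemma no_infinite_monic_chain:
  assumes s: "\<And>i. monic_in C (P \<phi>) (s i) \<and> tgt C (s i) = x"
    and chain: "(\<forall>i. subobject_le C (s i) (s (Suc i)) \<and> \<not> subobject_le C (s (Suc i)) (s i)) \<or>
      (\<forall>i. subobject_le C (s (Suc i)) (s i) \<and> \<not> subobject_le C (s i) (s (Suc i)))"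
  shows False
proof -
  obtain \<eta> where \<eta>: "0 < \<eta>" "\<eta> < 1 / 2" "finite_length C (slice C P {\<phi> - \<eta><..<\<phi> + \<eta>})"
    using locally_finite unfolding locally_finite_def by blast
  have "x \<in> P \<phi>" using monic_inD(3) s by metis
  then have x: "x \<in> slice C P {\<phi> - \<eta><..<\<phi> + \<eta>}" using slice_base \<eta> by simp
  have "\<forall>i. strict_monic_in C (slice C P {\<phi> - \<eta><..<\<phi> + \<eta>}) (s i) \<and> tgt C (s i) = x"
    using monic_strict \<eta> s by blast
  then obtain N where N: "\<forall>i\<ge>N. subobject_le C (s i) (s N) \<and> subobject_le C (s N) (s i)"
    using \<eta>(3) x chain unfolding finite_length_def by blast
  then show False using chain le_SucI[OF le_refl, of N] by blast
qed

text \<open>Otherwise every non-zero subobject contains a smaller non-zero one, and an endless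
  descending chain starts at the identity of \<open>c\<close>.\<close>

lemma stable_subobject:
  assumes c: "c \<in> P \<phi>" "\<not> zero_obj C c"
  obtains f where "monic_in C (P \<phi>) f" "tgt C f = c" "simple_in C (P \<phi>) (src C f)"
proof (rule ccontr)
  note witness = that
  assume "\<not> thesis"
  then have ns: "\<not> simple_in C (P \<phi>) (src C f)" if "monic_in C (P \<phi>) f" "tgt C f = c" for f
    using that witness by blast
  let ?M = "\<lambda>f. monic_in C (P \<phi>) f \<and> tgt C f = c \<and> \<not> zero_obj C (src C f)"
  have cH: "idm C c \<in> Hom C c c" using idm_Hom P_obj[OF c(1)] by blast
  have start: "?M (idm C c)"
    using monic_inI[OF cH c(1,1)] cmp_idm_left Hom_src[OF cH] Hom_tgt[OF cH] c(2) by metis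
  have step: "\<exists>f'. ?M f' \<and> subobject_le C f' f \<and> \<not> subobject_le C f f'" if f: "?M f" for f
  proof -
    have fa: "src C f \<in> P \<phi>" "f \<in> Hom C (src C f) c" using f monic_inD[of "P \<phi>" f] by auto
    obtain k where k: "monic_in C (P \<phi>) k" "tgt C k = src C f" "\<not> zero_obj C (src C k)" "\<not> is_iso C k"
      using ns[of f] f fa(1) unfolding simple_in_def by blast
    note fk = monic_in_cmp[OF conjunct1[OF f] k(1,2)]
    have kH: "k \<in> Hom C (src C k) (src C f)" using monic_inD(1)[OF k(1)] k(2) by simp
    \<comment> \<open>A factorisation of \<open>f\<close> through \<open>f \<cdot> k\<close> gives
      \<open>k\<close> a right inverse, and a monomorphism with one is an isomorphism.\<close>
    have "\<not> subobject_le C f (f \<cdot> k)"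
    proof
      assume "subobject_le C f (f \<cdot> k)"
      then obtain l where l: "l \<in> Hom C (src C f) (src C k)" "f = (f \<cdot> k) \<cdot> l"
        unfolding subobject_le_def using fk(2) by auto
      have "f \<cdot> (k \<cdot> l) = f \<cdot> idm C (src C f)"
        using cmp_assoc[OF l(1) kH fa(2)] l(2) cmp_idm_right[OF fa(2)] by simp
      then have "k \<cdot> l = idm C (src C f)"
        using monic_inD(4)[OF conjunct1[OF f] fa(1) cmp_Hom[OF l(1) kH] idm_Hom[OF P_obj[OF fa(1)]]]
        by blast
      then show False using monic_in_retract_iso[OF k(1)] l(1) k(2,4) P_obj by auto
    qed
    moreover have "subobject_le C (f \<cdot> k) f" unfolding subobject_le_def using fk(2) kH by auto
    ultimately show ?thesis using fk f k(3) by auto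
  qed
  obtain s where "\<And>i. ?M (s i) \<and> subobject_le C (s (Suc i)) (s i) \<and> \<not> subobject_le C (s i) (s (Suc i))"
    using dependent_nat_choice[of "\<lambda>_. ?M" "\<lambda>_ f f'. subobject_le C f' f \<and> \<not> subobject_le C f f'"]
      start step by metis
  then show False using no_infinite_monic_chain[of \<phi> s c] by blast
qed

text \<open>If \<open>Q x\<close> fails, any subobject with property \<open>Q\<close> can be
  enlarged by a stable subobject of the quotient. Starting from zero this gives an endless ascending
  chain.\<close>

lemma semistable_induct:
  assumes x: "x \<in> P \<phi>"
    and zero: "\<And>z. zero_obj C z \<Longrightarrow> Q z"
    and stable: "\<And>s. simple_in C (P \<phi>) s \<Longrightarrow> Q s"
    and ext: "\<And>x y z f g h. \<lbrakk>tri x y z f g h; x \<in> P \<phi>; y \<in> P \<phi>; z \<in> P \<phi>; Q x; Q z\<rbrakk> \<Longrightarrow> Q y"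
  shows "Q x"
proof (rule ccontr)
  assume nQ: "\<not> Q x"
  let ?M = "\<lambda>f. monic_in C (P \<phi>) f \<and> tgt C f = x \<and> Q (src C f)"
  obtain o' where o': "zero_obj C o'" using ex_zero_obj by blast
  have start: "?M (arr_zero C o' x)"
    using cone_monic[OF tri_idm_right[OF P_obj[OF x] o'] P_zero[OF o'] x x] zero[OF o']
      arr_zero_Hom[OF zero_obj_obj[OF o'] P_obj[OF x]] Hom_src Hom_tgt by metis
  have step: "\<exists>f'. ?M f' \<and> subobject_le C f f' \<and> \<not> subobject_le C f' f" if f: "?M f" for f
  proof -
    define e where "e = src C f"
    have e: "f \<in> Hom C e x" "e \<in> P \<phi>" "Q e" using f monic_inD[of "P \<phi>" f] unfolding e_def by auto
    obtain c g h where t: "tri e x c f g h" using ex_cone[OF e(1)] .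
    have c: "c \<in> P \<phi>" using monic_cone[OF conjunct1[OF f] t] .
    have "\<not> zero_obj C c" using ext[OF t e(2) x c e(3)] zero nQ by blast
    then obtain k where k: "monic_in C (P \<phi>) k" "tgt C k = c" "simple_in C (P \<phi>) (src C k)"
      using stable_subobject[OF c] by blast
    define s where "s = src C k"
    have kH: "k \<in> Hom C s c" using monic_inD(1)[OF k(1)] k(2) unfolding s_def by simp
    have s: "s \<in> P \<phi>" "\<not> zero_obj C s" "Q s" using k(3) stable unfolding s_def simple_in_def by auto
    obtain c' k1 k2 where t': "tri s c c' k k1 k2" using ex_cone[OF kH] .
    have c': "c' \<in> P \<phi>" using monic_cone[OF k(1) t'] .
    have H: "g \<in> Hom C x c" "k1 \<in> Hom C c c'" using t t' unfolding tri_def by auto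
    \<comment> \<open>The preimage of \<open>s\<close> in \<open>x\<close>, built as the cocone of
      the map from \<open>x\<close> to the quotient of \<open>c\<close> by \<open>s\<close>.\<close>
    obtain e' f' h' where t'': "tri e' x c' f' (k1 \<cdot> g) h'" using ex_cocone[OF cmp_Hom[OF H]] .
    have f'H: "f' \<in> Hom C e' x" using t'' unfolding tri_def by blast
    \<comment> \<open>The octahedron for x -> c -> c' uses rotated triangles, so the extension of
      \<open>s\<close> by \<open>e\<close> appears shifted first.\<close>
    obtain a b d where ts: "tri (shift_obj C e) (shift_obj C e') (shift_obj C s) a b d"
      using octahedron[OF tri_rotate[OF t] tri_rotate[OF t'] tri_rotate[OF t'']] .
    obtain a' b' d' where t3: "tri e e' s a' b' d'"
      using tri_unshift[OF ts P_obj[OF e(2)] tri_obj(1)[OF t''] P_obj[OF s(1)]] .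
    have e': "e' \<in> P \<phi>" using P_ext[OF t3 e(2) s(1)] .
    have "Q e'" using ext[OF t3 e(2) e' s(1) e(3) s(3)] .
    moreover have mon: "monic_in C (P \<phi>) f'" using cone_monic[OF t'' e' x c'] .
    moreover have "subobject_le C f f'"
    proof -
      have "(k1 \<cdot> g) \<cdot> f = arr_zero C e c'"
        using cmp_assoc[OF e(1) H] tri_cmp_zero[OF t] cmp_zero_right[OF H(2) P_obj[OF e(2)]] by simp
      then obtain l where "l \<in> Hom C e e'" "f' \<cdot> l = f" using exact_left[OF t'' e(1)] by blast
      then show ?thesis unfolding subobject_le_def using Hom_src[OF f'H] e_def by auto
    qed
    moreover have "\<not> subobject_le C f' f"
    \<comment> \<open>Containment both ways would make \<open>e\<close> and \<open>e'\<close>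
      isomorphic, but their charges differ by the non-zero charge of \<open>s\<close>.\<close>
    proof
      assume "subobject_le C f' f"
      then obtain l' where l': "l' \<in> Hom C e' e" "f' = f \<cdot> l'"
        unfolding subobject_le_def using Hom_src[OF f'H] e_def by auto
      obtain l where l: "l \<in> Hom C e e'" "f = f' \<cdot> l"
        using \<open>subobject_le C f f'\<close> unfolding subobject_le_def using Hom_src[OF f'H] e_def by auto
      have "f \<cdot> (l' \<cdot> l) = f' \<cdot> l"
        unfolding cmp_assoc[OF l(1) l'(1) e(1), symmetric] l'(2)[symmetric] ..
      then have "f \<cdot> (l' \<cdot> l) = f \<cdot> idm C e"
        unfolding l(2)[symmetric] cmp_idm_right[OF e(1)] .
      then have 1: "l' \<cdot> l = idm C e"
        using monic_inD(4)[OF conjunct1[OF f] e(2)] cmp_Hom[OF l(1) l'(1)] idm_Hom[OF P_obj[OF e(2)]]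
        unfolding e_def by blast
      have "f' \<cdot> (l \<cdot> l') = f \<cdot> l'"
        unfolding cmp_assoc[OF l'(1) l(1) f'H, symmetric] l(2)[symmetric] ..
      then have "f' \<cdot> (l \<cdot> l') = f' \<cdot> idm C e'"
        unfolding l'(2)[symmetric] cmp_idm_right[OF f'H] .
      then have 2: "l \<cdot> l' = idm C e'"
        using monic_inD(4)[OF mon e'] cmp_Hom[OF l'(1) l(1)] idm_Hom[OF P_obj[OF e']] Hom_src[OF f'H]
        by simp
      have "isomorphic C e e'" unfolding isomorphic_def using is_isoI[OF l(1) l'(1) 1 2] l(1) by blast
      then show False
        using charge_isomorphic charge_tri[OF t3] charge_nonzero[OF s(1,2)] by simp
    qed
    ultimately show ?thesis using Hom_src[OF f'H] Hom_tgt[OF f'H] by metis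
  qed
  obtain s where "\<And>i. ?M (s i) \<and> subobject_le C (s i) (s (Suc i)) \<and> \<not> subobject_le C (s (Suc i)) (s i)"
    using dependent_nat_choice[of "\<lambda>_. ?M" "\<lambda>_ f f'. subobject_le C f f' \<and> \<not> subobject_le C f' f"]
      start step by metis
  then show False using no_infinite_monic_chain[of \<phi> s x] by blast
qed

end

section \<open>Comparison of two stability conditions\<close>

context stability
begin

text \<open>All charges lie on one ray, so their moduli add.\<close>

lemma mass_semistable_ext:
  assumes t: "tri x y z f g h" and P: "x \<in> P \<phi>" "y \<in> P \<phi>" "z \<in> P \<phi>"
  shows "mass C q (P, Z) y = mass C q (P, Z) x + mass C q (P, Z) z"
proof -
  have "charge x + charge z = of_real (cmod (charge x) + cmod (charge z)) * exp (\<i> * pi * \<phi>)"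
    using charge_phase'[OF P(1)] charge_phase'[OF P(3)] by (simp add: distrib_right)
  then have "cmod (charge y) = \<bar>cmod (charge x) + cmod (charge z)\<bar>"
    unfolding charge_tri[OF t] by (simp only: norm_mult norm_of_real) simp
  then show ?thesis using mass_semistable P by (simp add: distrib_left)
qed

lemma mass_zero: "zero_obj C z \<Longrightarrow> mass C q (P, Z) z = 0"
  using mass_semistable[OF P_zero] charge_zero by simp

lemma mass_pos:
  assumes "x \<in> obj C" "\<not> zero_obj C x" "q > 0"
  shows "0 < mass C q (P, Z) x"
proof -
  obtain n E A \<phi> where HN: "HN_filtration C P x n E A \<phi>" using HN_exists[OF assms(1)] .
  have "n \<noteq> 0" using HN assms(2) unfolding HN_filtration_def by auto
  moreover have "0 < q powr \<phi> i * cmod (charge (A i))" if "i < n" for i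
    using charge_nonzero HN_factor[OF HN that] assms(3) by simp
  ultimately show ?thesis unfolding mass_HN[OF HN] by (intro sum_pos) auto
qed

text \<open>The Harder--Narasimhan filtration is refined by stable filtrations of its factors;
  additivity of the mass is passed on so that estimates can be summed along the refinement.\<close>

lemma object_induct:
  assumes y: "y \<in> obj C"
    and zero: "\<And>z. zero_obj C z \<Longrightarrow> Q z"
    and stable: "\<And>\<phi> s. simple_in C (P \<phi>) s \<Longrightarrow> Q s"
    and ext: "\<And>x y z f g h. \<lbrakk>tri x y z f g h;
        \<And>q. mass C q (P, Z) y = mass C q (P, Z) x + mass C q (P, Z) z; Q x; Q z\<rbrakk> \<Longrightarrow> Q y"
  shows "Q y"
proof -
  have semistable: "Q x" if "x \<in> P \<phi>" for x \<phi>
    using that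
  proof (rule semistable_induct)
    fix x y z f g h
    assume "tri x y z f g h" "x \<in> P \<phi>" "y \<in> P \<phi>" "z \<in> P \<phi>" "Q x" "Q z"
    then show "Q y" using ext mass_semistable_ext by blast
  qed (use zero stable in auto)
  obtain n E A \<phi> where "HN_filtration C P y n E A \<phi>" using HN_exists[OF y] .
  then show ?thesis
  proof (induction n arbitrary: y)
    case 0
    then show ?case using zero unfolding HN_filtration_def by auto
  next
    case (Suc n)
    note pre = HN_prefix[OF Suc(2), of n, simplified]
    have y: "y = E (Suc n)" using Suc(2) unfolding HN_filtration_def by blast
    obtain f g h where t: "tri (E n) y (A n) f g h" using HN_step[OF Suc(2) lessI] y by blast
    have A: "A n \<in> P (\<phi> n)" using HN_factor(1)[OF Suc(2) lessI] .
    have "mass C q (P, Z) y = mass C q (P, Z) (E n) + mass C q (P, Z) (A n)" for q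
      unfolding mass_HN[OF Suc(2)] mass_HN[OF pre] mass_semistable[OF A] by simp
    then show ?case using ext[OF t _ Suc.IH[OF pre] semistable[OF A]] by blast
  qed
qed

end

text \<open>\<open>b\<close> is the expected difference of phases. For a common semistable object
  with that difference, both sides of \<open>balance\<close> equal the ratio of the moduli of its
  two charges.\<close>

locale mass_comparison =
  \<sigma>: stability C P Z + \<tau>: stability C P' Z'
  for C :: "('o, 'm, 'e) triangulated_cat_scheme" (structure) and P Z P' Z' +
  fixes S :: "'o set" and q \<kappa> q' \<kappa>' b :: real
  assumes pos: "q > 0" "q' > 0" "\<kappa> > 0" "\<kappa>' > 0" and neq: "q \<noteq> q'"
    and balance: "\<kappa> * q powr b = \<kappa>' * q' powr b"
    and mass_q: "\<And>s. s \<in> S \<Longrightarrow> mass C q (P, Z) s = \<kappa> * mass C q (P', Z') s"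
    and mass_q': "\<And>s. s \<in> S \<Longrightarrow> mass C q' (P, Z) s = \<kappa>' * mass C q' (P', Z') s"
    and stable: "\<And>\<phi> s. simple_in C (P \<phi>) s \<Longrightarrow> s \<in> S"
    and stable': "\<And>\<phi> s. simple_in C (P' \<phi>) s \<Longrightarrow> s \<in> S"
begin

text \<open>Provides the reverse inclusion of semistable objects in
  \<open>same_orbit\<close>.\<close>

lemma swap: "mass_comparison C P' Z' P Z S q (inverse \<kappa>) q' (inverse \<kappa>') (- b)"
proof unfold_locales
  have "inverse (\<kappa> * q powr b) = inverse (\<kappa>' * q' powr b)" using balance by simp
  then show "inverse \<kappa> * q powr - b = inverse \<kappa>' * q' powr - b" by (simp add: powr_minus)
qed (use pos neq mass_q mass_q' stable stable' in \<open>auto simp: field_simps\<close>)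

text \<open>After taking logarithms, the difference of the two mass equations eliminates the moduli
  of the charges; with \<open>balance\<close> it forces the claim because the logarithms of
  \<open>q\<close> and \<open>q'\<close> differ.\<close>

lemma phase_shift:
  assumes s: "s \<in> S" "s \<in> P \<phi>" "s \<in> P' \<psi>" "\<not> zero_obj C s"
  shows "\<psi> = \<phi> + b"
proof -
  define u v where "u = cmod (Z (K_class C s))" and "v = cmod (Z' (K_class C s))"
  have uv: "u > 0" "v > 0" unfolding u_def v_def using \<sigma>.charge_nonzero \<tau>.charge_nonzero s by auto
  have "q powr \<phi> * u = \<kappa> * (q powr \<psi> * v)" "q' powr \<phi> * u = \<kappa>' * (q' powr \<psi> * v)"
    using mass_q[OF s(1)] mass_q'[OF s(1)] \<sigma>.mass_semistable[OF s(2)] \<tau>.mass_semistable[OF s(3)]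
    unfolding u_def v_def by simp_all
  then have "ln (q powr \<phi> * u) = ln (\<kappa> * (q powr \<psi> * v))" "ln (q' powr \<phi> * u) = ln (\<kappa>' * (q' powr \<psi> * v))"
    by simp_all
  then have "\<phi> * ln q + ln u = ln \<kappa> + (\<psi> * ln q + ln v)" "\<phi> * ln q' + ln u = ln \<kappa>' + (\<psi> * ln q' + ln v)"
    using pos uv by (simp_all add: ln_mult ln_powr)
  moreover have "ln (\<kappa> * q powr b) = ln (\<kappa>' * q' powr b)" using balance by simp
  then have "ln \<kappa> + b * ln q = ln \<kappa>' + b * ln q'" using pos by (simp add: ln_mult ln_powr)
  ultimately have "(\<phi> + b - \<psi>) * (ln q - ln q') = 0" by (simp add: algebra_simps)
  then show ?thesis using neq pos by simp
qed

lemma stable_semistable: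
  assumes x: "simple_in C (P \<phi>) x"
  shows "x \<in> P' (\<phi> + b)"
proof -
  \<comment> \<open>Proved for all objects by induction along \<open>\<tau>\<close>-stable filtrations; for \<open>x\<close> equality holds.\<close>
  let ?N = "\<sigma>.support_mass q \<phi>" and ?m = "\<lambda>y. \<kappa> * mass C q (P', Z') y"
  let ?Q = "\<lambda>y. ?N y \<le> ?m y \<and> (?N y = ?m y \<longrightarrow> y \<in> P' (\<phi> + b))"
  have xP: "x \<in> P \<phi>" using x unfolding simple_in_def by blast
  have "?Q x"
  proof (rule \<tau>.object_induct[OF \<sigma>.P_obj[OF xP]])
    fix z assume z: "zero_obj C z"
    then show "?Q z"
      using \<sigma>.support_mass_le(1)[OF pos(1) \<sigma>.zero_obj_obj[OF z], of \<phi>] \<sigma>.mass_zero \<tau>.mass_zero \<tau>.P_zero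
      by simp
  next
    fix \<psi> s assume s: "simple_in C (P' \<psi>) s"
    then have s': "s \<in> P' \<psi>" "\<not> zero_obj C s" unfolding simple_in_def by auto
    note le = \<sigma>.support_mass_le[OF pos(1) \<tau>.P_obj[OF s'(1)], of \<phi>]
    \<comment> \<open>Here \<open>?m s\<close> is the \<sigma>-mass of \<open>s\<close>. Equality
      makes \<open>s\<close> semistable of phase \<phi> for \<sigma> too, and then
      \<open>phase_shift\<close> applies.\<close>
    show "?Q s"
      using le phase_shift[OF stable'[OF s] _ s'] s'(1) mass_q[OF stable'[OF s]] by auto
  next
    fix x y z f g h
    assume t: "\<sigma>.tri x y z f g h"
      and m: "\<And>q. mass C q (P', Z') y = mass C q (P', Z') x + mass C q (P', Z') z"
      and Q: "?Q x" "?Q z"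
    have sub: "?N y \<le> ?N x + ?N z" using \<sigma>.support_mass_subadditive[OF t] .
    have split: "?m y = ?m x + ?m z" using m[of q] by (simp add: distrib_left)
    show "?Q y"
    proof (intro conjI impI)
      show "?N y \<le> ?m y" using sub split Q by linarith
      assume "?N y = ?m y"
      \<comment> \<open>Subadditivity of \<open>?N\<close> against additivity of \<open>?m\<close>
        leaves no slack, so equality descends to both ends of the triangle.\<close>
      then have "?N x = ?m x" "?N z = ?m z" using sub split Q by linarith+
      then show "y \<in> P' (\<phi> + b)" using \<tau>.P_ext[OF t] Q by blast
    qed
  qed
  moreover have "?N x = ?m x" using \<sigma>.support_mass_semistable[OF xP] mass_q[OF stable[OF x]] by simp
  ultimately show ?thesis by blast
qed

lemma semistable_subset: "P \<phi> \<subseteq> P' (\<phi> + b)"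
proof
  fix x assume "x \<in> P \<phi>"
  then show "x \<in> P' (\<phi> + b)"
  proof (rule \<sigma>.semistable_induct)
    fix x y z f g h
    assume "\<sigma>.tri x y z f g h" "x \<in> P' (\<phi> + b)" "z \<in> P' (\<phi> + b)"
    then show "y \<in> P' (\<phi> + b)" using \<tau>.P_ext by blast
  qed (use \<tau>.P_zero stable_semistable in auto)
qed

text \<open>The argument of the factor comes from the shift of phases by \<open>b\<close>, its
  modulus from comparing the \<open>q\<close>-masses.\<close>

lemma charge_stable:
  assumes s: "simple_in C (P \<phi>) s"
  shows "Z' (K_class C s) = exp (Complex (- ln (\<kappa> * q powr b)) (pi * b)) * Z (K_class C s)"
proof -
  have P: "s \<in> P \<phi>" using s unfolding simple_in_def by blast
  then have P': "s \<in> P' (\<phi> + b)" using semistable_subset by blast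
  have "q powr \<phi> * cmod (Z (K_class C s)) = \<kappa> * (q powr (\<phi> + b) * cmod (Z' (K_class C s)))"
    using mass_q[OF stable[OF s]] \<sigma>.mass_semistable[OF P] \<tau>.mass_semistable[OF P'] by simp
  then have "q powr \<phi> * cmod (Z (K_class C s)) = q powr \<phi> * (\<kappa> * q powr b * cmod (Z' (K_class C s)))"
    using pos by (simp add: powr_add)
  then have m: "cmod (Z (K_class C s)) = \<kappa> * q powr b * cmod (Z' (K_class C s))"
    using pos by simp
  have k: "0 < \<kappa> * q powr b" using pos by simp
  have "Complex (- ln (\<kappa> * q powr b)) (pi * b) = of_real (- ln (\<kappa> * q powr b)) + \<i> * pi * b"
    by (simp add: complex_eq_iff)
  then have "exp (Complex (- ln (\<kappa> * q powr b)) (pi * b)) =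
      of_real (inverse (\<kappa> * q powr b)) * exp (\<i> * pi * b)"
    by (simp only: exp_add exp_of_real exp_minus exp_ln[OF k])
  then have "exp (Complex (- ln (\<kappa> * q powr b)) (pi * b)) * Z (K_class C s) =
      of_real (inverse (\<kappa> * q powr b) * cmod (Z (K_class C s))) * (exp (\<i> * pi * b) * exp (\<i> * pi * \<phi>))"
    by (subst \<sigma>.charge_phase'[OF P]) simp
  also have "inverse (\<kappa> * q powr b) * cmod (Z (K_class C s)) = cmod (Z' (K_class C s))"
    using m pos by (simp add: field_simps)
  also have "exp (\<i> * pi * b) * exp (\<i> * pi * \<phi>) = exp (\<i> * pi * (\<phi> + b))"
    by (simp add: algebra_simps flip: exp_add)
  finally show ?thesis using \<tau>.charge_phase'[OF P'] by simp
qed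

text \<open>The slicings agree by inclusion in both directions. The charges agree on stable objects,
  hence on all objects by additivity, hence on the Grothendieck group.\<close>

lemma same_orbit: "(P', Z') = stab_act C (Complex (- ln (\<kappa> * q powr b)) (pi * b)) (P, Z)"
proof -
  interpret sw: mass_comparison C P' Z' P Z S q "inverse \<kappa>" q' "inverse \<kappa>'" "- b" by (rule swap)
  let ?w = "exp (Complex (- ln (\<kappa> * q powr b)) (pi * b))"
  have "P' \<psi> = P (\<psi> - b)" for \<psi>
    using semistable_subset[of "\<psi> - b"] sw.semistable_subset[of \<psi>] by auto
  moreover have "Z' k = ?w * Z k" if k: "k \<in> carrier (K_group C)" for k
  proof (rule \<sigma>.K_hom_eqI[OF \<tau>.Z_hom _ _ k])
    show "(\<lambda>k. ?w * Z k) \<in> hom (K_group C) complex_group"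
      using \<sigma>.Z_hom unfolding hom_def complex_group_def by (auto simp: distrib_left)
    fix x assume "x \<in> obj C"
    then show "Z' (K_class C x) = ?w * Z (K_class C x)"
    proof (rule \<sigma>.object_induct)
      fix z assume "zero_obj C z"
      then show "Z' (K_class C z) = ?w * Z (K_class C z)"
        using \<sigma>.charge_zero \<tau>.charge_zero by simp
    next
      fix x y z f g h
      assume t: "\<sigma>.tri x y z f g h"
        and "Z' (K_class C x) = ?w * Z (K_class C x)" "Z' (K_class C z) = ?w * Z (K_class C z)"
      then show "Z' (K_class C y) = ?w * Z (K_class C y)"
        by (simp only: \<sigma>.charge_tri[OF t] \<tau>.charge_tri[OF t] distrib_left)
    qed (rule charge_stable)
  qed
  then have "Z' = (\<lambda>k \<in> carrier (K_group C). ?w * Z k)"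
    using \<tau>.Z_extensional by (auto simp: fun_eq_iff extensional_def restrict_def)
  ultimately show ?thesis unfolding stab_act_def by auto
qed

end

section \<open>Orbits of the action and points of projective space\<close>

lemma stab_act_stab_act: "stab_act C w (stab_act C w' \<sigma>) = stab_act C (w + w') \<sigma>"
  unfolding stab_act_def by (auto simp: fun_eq_iff exp_add add_divide_distrib algebra_simps)

lemma stab_act_zero: "\<sigma> \<in> Stab C \<Longrightarrow> stab_act C 0 \<sigma> = \<sigma>"
  unfolding stab_act_def Stab_def by (auto simp: fun_eq_iff restrict_def extensional_def)

lemma equiv_stab_rel: "equiv (Stab C) (stab_rel C)"
proof (rule equivI)
  show "stab_rel C \<subseteq> Stab C \<times> Stab C" unfolding stab_rel_def by auto
  show "refl_on (Stab C) (stab_rel C)"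
    unfolding refl_on_def stab_rel_def by (auto intro: exI[of _ 0] simp: stab_act_zero)
  show "sym (stab_rel C)"
  proof (rule symI)
    fix \<sigma> \<tau> assume "(\<sigma>, \<tau>) \<in> stab_rel C"
    then obtain w where "\<sigma> \<in> Stab C" "\<tau> \<in> Stab C" "\<tau> = stab_act C w \<sigma>" unfolding stab_rel_def by auto
    moreover then have "\<sigma> = stab_act C (- w) \<tau>" by (simp add: stab_act_stab_act stab_act_zero)
    ultimately show "(\<tau>, \<sigma>) \<in> stab_rel C" unfolding stab_rel_def by blast
  qed
  show "trans (stab_rel C)"
    unfolding trans_def stab_rel_def using stab_act_stab_act by blast
qed

text \<open>The same filtration serves both conditions, with all phases moved by
  \<open>Im w / pi\<close>.\<close>

lemma mass_stab_act:
  assumes "stability C P Z" "stability C P' Z'" "(P', Z') = stab_act C w (P, Z)" "x \<in> obj C"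
  shows "mass C q (P', Z') x = exp (Re w) * q powr (Im w / pi) * mass C q (P, Z) x"
proof -
  interpret \<sigma>: stability C P Z by fact
  interpret \<tau>: stability C P' Z' by fact
  have P': "P' = (\<lambda>\<phi>. P (\<phi> - Im w / pi))" and Z': "Z' = (\<lambda>k \<in> carrier (K_group C). exp w * Z k)"
    using assms(3) unfolding stab_act_def by auto
  obtain n E A \<phi> where HN: "HN_filtration C P x n E A \<phi>" using \<sigma>.HN_exists[OF assms(4)] .
  then have HN': "HN_filtration C P' x n E A (\<lambda>i. \<phi> i + Im w / pi)"
    unfolding HN_filtration_def P' by simp
  have "cmod (Z' (K_class C (A i))) = exp (Re w) * cmod (Z (K_class C (A i)))" if "i < n" for i
    unfolding Z' using \<sigma>.K_class_carrier[OF \<sigma>.P_obj[OF \<sigma>.HN_factor(1)[OF HN that]]]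
    by (simp add: norm_mult)
  then show ?thesis
    unfolding \<sigma>.mass_HN[OF HN] \<tau>.mass_HN[OF HN']
    by (simp add: sum_distrib_left powr_add mult_ac)
qed

lemma mass_map_eq_imp_proportional:
  assumes C: "triangulated_category C" and S: "S \<noteq> {}" "S \<subseteq> obj C" "\<And>x. x \<in> S \<Longrightarrow> \<not> zero_obj C x"
    and st: "\<sigma> \<in> Stab C" "\<tau> \<in> Stab C" and q: "q > 0"
    and eq: "mass_map C S q (stab_rel C `` {\<sigma>}) = mass_map C S q (stab_rel C `` {\<tau>})"
  obtains \<kappa> where "\<kappa> > 0" "\<And>s. s \<in> S \<Longrightarrow> mass C q \<sigma> s = \<kappa> * mass C q \<tau> s"
proof -
  interpret triangulated_category C by fact
  have stab: "stability C (fst \<rho>) (snd \<rho>)" if "\<rho> \<in> Stab C" for \<rho>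
    using that by unfold_locales simp
  have pos: "0 < mass C q \<rho> x" if "\<rho> \<in> Stab C" "x \<in> S" for \<rho> x
    using stability.mass_pos[OF stab[OF that(1)]] that(2) S q by auto
  let ?m = "\<lambda>x \<in> S. mass C q \<sigma> x"
  obtain x where x: "x \<in> S" using S by blast
  have "?m x \<noteq> 0" using pos[OF st(1) x] x by simp
  then have "?m \<in> nonzero_funs S" unfolding nonzero_funs_def using x by (intro CollectI conjI bexI) auto
  then have "(?m, ?m) \<in> proj_rel S"
    unfolding proj_rel_def by (auto simp: fun_eq_iff intro!: exI[of _ "1::real"])
  moreover have "(\<sigma>, \<sigma>) \<in> stab_rel C" using equiv_stab_rel st(1) by (meson equiv_def refl_onD)
  \<comment> \<open>\<open>mass_map\<close> is a union over an orbit, so equality only makes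
    \<open>?m\<close> proportional to the mass of some \<rho> in the orbit of \<tau>.\<close>
  ultimately have "?m \<in> mass_map C S q (stab_rel C `` {\<tau>})"
    unfolding eq[symmetric] unfolding mass_map_def by blast
  then obtain \<rho> where \<rho>: "(\<tau>, \<rho>) \<in> stab_rel C" "((\<lambda>x \<in> S. mass C q \<rho> x), ?m) \<in> proj_rel S"
    unfolding mass_map_def by blast
  then obtain c where c: "?m = (\<lambda>x \<in> S. c * (\<lambda>x \<in> S. mass C q \<rho> x) x)" unfolding proj_rel_def by blast
  obtain w where w: "\<rho> \<in> Stab C" "\<rho> = stab_act C w \<tau>" using \<rho>(1) unfolding stab_rel_def by blast
  \<comment> \<open>The projective scalar times the factor by which passing from \<tau> to \<rho>
    rescales masses. It is positive because both masses are positive on the non-zero object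
    \<open>x\<close>.\<close>
  define \<kappa> where "\<kappa> = c * (exp (Re w) * q powr (Im w / pi))"
  have proportional: "mass C q \<sigma> s = \<kappa> * mass C q \<tau> s" if "s \<in> S" for s
  proof -
    have "mass C q \<sigma> s = c * mass C q \<rho> s" using fun_cong[OF c, of s] that by simp
    also have "mass C q \<rho> s = exp (Re w) * q powr (Im w / pi) * mass C q \<tau> s"
      using mass_stab_act[OF stab[OF st(2)] stab[OF w(1)], of w s q] w(2) that S(2) by auto
    finally show ?thesis unfolding \<kappa>_def by simp
  qed
  have "\<kappa> > 0" using proportional[OF x] pos[OF st(1) x] pos[OF st(2) x] by (simp add: zero_less_mult_iff)
  then show ?thesis using that proportional by blast
qed

theorem theorem4p3:
  fixes C :: "('o, 'm) triangulated_cat"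
    and S :: "'o set"
    and n :: nat
    and q :: "nat \<Rightarrow> real"
  assumes "triangulated_category C"
    and "S \<noteq> {}"
    and "S \<subseteq> obj C"
    and "\<And>x. x \<in> S \<Longrightarrow> \<not> zero_obj C x"
    and "\<And>\<tau> \<phi> x. \<tau> \<in> Stab C \<Longrightarrow> stable_obj C \<tau> \<phi> x \<Longrightarrow> x \<in> S"
    and "n \<ge> 2"
    and "\<And>i. i \<in> {1..n} \<Longrightarrow> q i > 0"
    and "inj_on q {1..n}"
  shows "inj_on (\<lambda>X. \<lambda>i \<in> {1..n}. mass_map C S (q i) X) (Stab_mod C)"
proof (rule inj_onI)
  interpret triangulated_category C by fact
  fix X Y
  assume X: "X \<in> Stab_mod C" and Y: "Y \<in> Stab_mod C"
    and eq: "(\<lambda>i \<in> {1..n}. mass_map C S (q i) X) = (\<lambda>i \<in> {1..n}. mass_map C S (q i) Y)"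
  obtain P Z where \<sigma>: "(P, Z) \<in> Stab C" "X = stab_rel C `` {(P, Z)}"
    using X unfolding Stab_mod_def quotient_def by auto
  obtain P' Z' where \<tau>: "(P', Z') \<in> Stab C" "Y = stab_rel C `` {(P', Z')}"
    using Y unfolding Stab_mod_def quotient_def by auto
  have eq': "mass_map C S (q i) X = mass_map C S (q i) Y" if "i \<in> {1..n}" for i
    using fun_cong[OF eq, of i] that by simp
  have q: "q 1 > 0" "q 2 > 0" "q 1 \<noteq> q 2"
    using assms(6-8) inj_onD[of q "{1..n}" 1 2] by auto
  obtain \<kappa> where \<kappa>: "\<kappa> > 0" "\<And>s. s \<in> S \<Longrightarrow> mass C (q 1) (P, Z) s = \<kappa> * mass C (q 1) (P', Z') s"
    using mass_map_eq_imp_proportional[OF assms(1-4) \<sigma>(1) \<tau>(1) q(1)] eq'[of 1] assms(6) \<sigma>(2) \<tau>(2)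
    by auto
  obtain \<kappa>' where \<kappa>': "\<kappa>' > 0" "\<And>s. s \<in> S \<Longrightarrow> mass C (q 2) (P, Z) s = \<kappa>' * mass C (q 2) (P', Z') s"
    using mass_map_eq_imp_proportional[OF assms(1-4) \<sigma>(1) \<tau>(1) q(2)] eq'[of 2] assms(6) \<sigma>(2) \<tau>(2)
    by auto
  \<comment> \<open>The solution of \<open>balance\<close> after taking logarithms; the denominator
    is non-zero as the two parameters differ.\<close>
  define b where "b = (ln \<kappa>' - ln \<kappa>) / (ln (q 1) - ln (q 2))"
  have "b * (ln (q 1) - ln (q 2)) = ln \<kappa>' - ln \<kappa>" unfolding b_def using q by simp
  then have "ln (\<kappa> * q 1 powr b) = ln (\<kappa>' * q 2 powr b)"
    using q \<kappa>(1) \<kappa>'(1) by (simp add: ln_mult ln_powr algebra_simps)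
  then have balance: "\<kappa> * q 1 powr b = \<kappa>' * q 2 powr b" using q \<kappa>(1) \<kappa>'(1) by simp
  interpret mass_comparison C P Z P' Z' S "q 1" \<kappa> "q 2" \<kappa>' b
    using \<sigma>(1) \<tau>(1) q \<kappa> \<kappa>' balance assms(5)[OF \<sigma>(1)] assms(5)[OF \<tau>(1)]
    by unfold_locales (auto simp: stable_obj_def)
  have "((P, Z), (P', Z')) \<in> stab_rel C" using same_orbit \<sigma>(1) \<tau>(1) unfolding stab_rel_def by blast
  then show "X = Y" using equiv_class_eq[OF equiv_stab_rel] \<sigma>(2) \<tau>(2) by simp
qed

end
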